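(* Let $A\in\mathbb{R}^{n\times n}$, $B\in\mathbb{R}^{n\times m}$ with $m\ge 2$ (multi-input case), and let $Q=\mathrm{diag}(q_1,\dots,q_n)\succeq 0$ and $R=\mathrm{diag}(r_1,\dots,r_m)\succ 0$, with $(A,B)$ stabilizable and $(A,\sqrt Q)$ detectable. Consider the LTI system $\dot x=Ax+Bu$ with static state feedback $u=Kx$, $K=(k_{ji})\in\mathbb{R}^{m\times n}$, where $K$ is such that the closed loop is stable (all eigenvalues of $A+BK$ have negative real part), with zero initial state and with a unit impulse signal injected through each of the $m$ input channels, i.e. with $\delta_v\in\mathbb{R}^m$ denoting the vector of impulse signals, $x=x(K)=A_+(K)B\delta_v$ and $u=u(K)=Kx$. Let $$J(K)=\int_0^\infty\tfrac12\left(x^TQx+u^TRu\right)dt .$$ Then the gradient of $J$ with respect to $K$ is $$\frac{dJ(K)}{dK}=\int_0^\infty\sum_{i=1}^n q_i\,x_i\,\frac{\partial x_i(K)}{\partial K}\,dt+\int_0^\infty\sum_{j=1}^m r_j\,u_j\,\frac{\partial u_j(K)}{\partial K}\,dt ,$$ where, for every $i=1,\dots,n$, $$\frac{\partial x_i(K)}{\partial K}=\left(A_+(K)B\,\delta_v\,e_i^TA_+(K)B\right)^T\in\mathbb{R}^{m\times n},$$ with $e_i\in\mathbb{R}^n$ the $i$th standard basis vector, and, for every $j=1,\dots,m$, $\partial u_j(K)/\partial K$ is the $m\times n$ matrix whose entry in row $f$ and column $g$ is $$\frac{\partial u_j(K)}{\partial k_{fg}}=\begin{cases}x_g+\displaystyle\sum_{i=1}^n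 k_{ji}\frac{\partial x_i(K)}{\partial k_{fg}}, & f=j,\\[1ex] \displaystyle\sum_{i=1}^n k_{ji}\frac{\partial x_i(K)}{\partial k_{fg}}, & f\ne j,\end{cases}$$ where $\partial x_i(K)/\partial k_{fg}$ is the entry in row $f$ and column $g$ of $\partial x_i(K)/\partial K$.
   Context: $A_+(K)=(sI-A-BK)^{-1}$ is a transfer matrix. Mixed time/transform notation is used: for a stable rational transfer matrix $H(s)$ and a signal $w(t)$, $Hw$ denotes the time-domain output of the system with transfer matrix $H(s)$ driven by $w$ from zero initial conditions. The vector $\delta_v$ has all $m$ entries equal to the unit impulse $\delta$. Thus $x=A_+(K)B\delta_v$ is the solution of $\dot x=(A+BK)x+B\delta_v$ started from zero, i.e. $x(t)=e^{(A+BK)t}B\mathbf{1}$ for $t>0$, where $\mathbf 1\in\mathbb{R}^m$ is the all-ones vector; $x_i$ and $u_j$ are the $i$th and $j$th components of $x$ and $u$. The feedback signal $u=Kx$ does not include the injected impulses. The expression $A_+(K)B\,\delta_v\,e_i^TA_+(K)B$ denotes the $n\times m$ matrix-valued time-domain signal with Laplace transform $(sI-A-BK)^{-1}B\,\mathbf 1\,e_i^T(sI-A-BK)^{-1}B$. $\partial x_i(K)/\partial K$ and $\partial u_j(K)/\partial K$ are, at each time $t$, the derivatives of the scalars $x_i(K)(t)$, $u_j(K)(t)$ with respect to the entries of $K$, arranged in the same shape as $K$; $dJ/dK$ is likewise arranged in the shape of $K$. *)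

theory Defs
  imports "HOL-Analysis.Analysis"
begin

definition complex_mat :: "real^'a^'b \<Rightarrow> complex^'a^'b" where
  "complex_mat M = map_matrix complex_of_real M"

definition eigenvalue :: "complex^'n^'n \<Rightarrow> complex \<Rightarrow> bool" where
  "eigenvalue M l \<longleftrightarrow> (\<exists>v. v \<noteq> 0 \<and> M *v v = l *s v)"

definition hurwitz :: "real^'n^'n \<Rightarrow> bool" where
  "hurwitz M \<longleftrightarrow> (\<forall>l. eigenvalue (complex_mat M) l \<longrightarrow> Re l < 0)"

definition stabilizable :: "real^'n^'n \<Rightarrow> real^'m^'n \<Rightarrow> bool" where
  "stabilizable A B \<longleftrightarrow> (\<exists>F :: real^'n^'m. hurwitz (A + B ** F))"

definition detectable :: "real^'n^'n \<Rightarrow> real^'n^'p \<Rightarrow> bool" where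
  "detectable A C \<longleftrightarrow> (\<exists>L :: real^'p^'n. hurwitz (A + L ** C))"

definition diag_mat :: "real^'n \<Rightarrow> real^'n^'n" where
  "diag_mat d = (\<chi> i j. if i = j then d $ i else 0)"

definition pos_semidef :: "real^'n^'n \<Rightarrow> bool" where
  "pos_semidef M \<longleftrightarrow> transpose M = M \<and> (\<forall>v. v \<bullet> (M *v v) \<ge> 0)"

definition pos_def :: "real^'n^'n \<Rightarrow> bool" where
  "pos_def M \<longleftrightarrow> transpose M = M \<and> (\<forall>v. v \<noteq> 0 \<longrightarrow> v \<bullet> (M *v v) > 0)"

text \<open>The library multiplication on \<open>vec\<close> is componentwise and its \<open>exp\<close> does not cover
  matrices, so the power series is taken with the matrix product.\<close>

definition mat_exp :: "real^'n^'n \<Rightarrow> real^'n^'n" where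
  "mat_exp M = (\<Sum>k. (1 / fact k) *\<^sub>R (((**) M ^^ k) (mat 1)))"

text \<open>Zero initial state and a unit impulse in every input channel:
  the impulses move the state to \<open>B *v vec 1\<close> at time \<open>0+\<close>, where \<open>vec 1\<close> is the all-ones
  vector. The value at time 0 is the right limit; only times \<open>t \<ge> 0\<close> are meaningful.\<close>

definition state :: "real^'n^'n \<Rightarrow> real^'m^'n \<Rightarrow> real^'n^'m \<Rightarrow> real \<Rightarrow> real^'n" where
  "state A B K t = mat_exp (t *\<^sub>R (A + B ** K)) *v (B *v vec 1)"

definition feedback :: "real^'n^'n \<Rightarrow> real^'m^'n \<Rightarrow> real^'n^'m \<Rightarrow> real \<Rightarrow> real^'m" where
  "feedback A B K t = K *v state A B K t"

definition running_cost ::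
  "real^'n^'n \<Rightarrow> real^'m^'n \<Rightarrow> real^'n^'n \<Rightarrow> real^'m^'m \<Rightarrow> real^'n^'m \<Rightarrow> real \<Rightarrow> real" where
  "running_cost A B Q R K t =
     1/2 * (state A B K t \<bullet> (Q *v state A B K t) + feedback A B K t \<bullet> (R *v feedback A B K t))"

definition cost ::
  "real^'n^'n \<Rightarrow> real^'m^'n \<Rightarrow> real^'n^'n \<Rightarrow> real^'m^'m \<Rightarrow> real^'n^'m \<Rightarrow> real" where
  "cost A B Q R K = integral {0..} (running_cost A B Q R K)"

definition laplace_transform_of :: "(real \<Rightarrow> real) \<Rightarrow> (complex \<Rightarrow> complex) \<Rightarrow> bool" where
  "laplace_transform_of f F \<longleftrightarrow> (\<exists>c::real. \<forall>s. Re s > c \<longrightarrow>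
     (\<lambda>t. exp (- s * complex_of_real t) * complex_of_real (f t)) absolutely_integrable_on {0..} \<and>
     integral {0..} (\<lambda>t. exp (- s * complex_of_real t) * complex_of_real (f t)) = F s)"

text \<open>The time-domain signal with a given (strictly proper) transform. Being causal and
  continuous on \<open>{0..}\<close> selects a unique representative among the functions with that
  transform.\<close>

definition time_signal :: "(complex \<Rightarrow> complex) \<Rightarrow> real \<Rightarrow> real" where
  "time_signal F = (THE f. continuous_on {0..} f \<and> (\<forall>t<0. f t = 0) \<and> laplace_transform_of f F)"

definition time_signal_mat :: "(complex \<Rightarrow> complex^'a^'b) \<Rightarrow> real \<Rightarrow> real^'a^'b" where
  "time_signal_mat H t = (\<chi> i j. time_signal (\<lambda>s. H s $ i $ j) t)"

definition A_plus :: "real^'n^'n \<Rightarrow> real^'m^'n \<Rightarrow> real^'n^'m \<Rightarrow> complex \<Rightarrow> complex^'n^'n" where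
  "A_plus A B K s = matrix_inv (mat s - complex_mat A - complex_mat B ** complex_mat K)"

text \<open>The transform of the vector of unit impulses is the constant all-ones vector.\<close>

definition sens_transfer ::
  "real^'n^'n \<Rightarrow> real^'m^'n \<Rightarrow> real^'n^'m \<Rightarrow> 'n \<Rightarrow> complex \<Rightarrow> complex^'m^'n" where
  "sens_transfer A B K i s =
     A_plus A B K s ** complex_mat B ** (columnvector (vec 1) :: complex^1^'m)
       ** (rowvector (axis i 1) :: complex^'n^1) ** A_plus A B K s ** complex_mat B"

definition state_sens ::
  "real^'n^'n \<Rightarrow> real^'m^'n \<Rightarrow> real^'n^'m \<Rightarrow> 'n \<Rightarrow> real \<Rightarrow> real^'n^'m" where
  "state_sens A B K i t = transpose (time_signal_mat (sens_transfer A B K i) t)"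

definition feedback_sens ::
  "real^'n^'n \<Rightarrow> real^'m^'n \<Rightarrow> real^'n^'m \<Rightarrow> 'm \<Rightarrow> real \<Rightarrow> real^'n^'m" where
  "feedback_sens A B K j t = (\<chi> f g.
     if f = j then state A B K t $ g + (\<Sum>i\<in>UNIV. K $ j $ i * state_sens A B K i t $ f $ g)
     else (\<Sum>i\<in>UNIV. K $ j $ i * state_sens A B K i t $ f $ g))"

end

theory Submission
  imports Defs "HOL-Computational_Algebra.Fundamental_Theorem_Algebra"
begin

text \<open>Write \<open>M = A + B ** K\<close>. For a perturbation \<open>H\<close> of the gain, let \<open>y\<close> solve
  \<open>y' = M y + B H x\<close>, \<open>y 0 = 0\<close>. Then \<open>y\<close> is the first-order change of the state \<open>x\<close>, and
  transforming its equation gives the transfer matrix of the sensitivity; uniqueness of the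
  Laplace transform identifies it with \<^const>\<open>state_sens\<close>.
  Everything else rests on one estimate: if \<open>M\<close> is Hurwitz there are \<open>b > 0\<close> and \<open>C\<close> such that
  \<open>w' = M w + z\<close> with \<open>norm (z t) \<le> D * exp (- b * t)\<close> implies
  \<open>norm (w t) \<le> C * (norm (w 0) + D) * exp (- b * t)\<close>. Since the rate \<open>b\<close> is not lost, the
  estimate can be iterated: the perturbed state, \<open>y\<close>, and the remainder of the expansion are
  \<open>O(1)\<close>, \<open>O(norm H)\<close> and \<open>O((norm H)\<^sup>2)\<close> times \<open>exp (- b * t)\<close>. Hence the cost has a quadratic
  remainder as well, and no interchange of limit and integral is needed.\<close>

section \<open>Orbits of linear systems\<close>

text \<open>The estimate has to cover defective matrices, where Jordan blocks add powers of
  \<open>t\<close> to the exponentials; a rate \<open>b\<close> strictly inside the spectral gap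
  absorbs them. It is obtained from a product of factors \<open>M - l I\<close> that annihilates
  every vector. Peeling off one factor leaves scalar equations with coefficient \<open>l\<close>,
  driven by a signal already known to decay at rate \<open>b\<close>, and \<open>Re l < - b\<close>
  makes such an equation reproduce the rate of its forcing. Because the estimate admits a forcing, a
  change \<open>H\<close> of the gain can be treated as the forcing \<open>B H x\<close> of the
  unperturbed system. On the transform side, the sensitivity is specified only by a description: the
  continuous signal with a given transform. Computing the transform of \<open>y\<close> therefore
  does not yet identify the two; injectivity of the Laplace transform on continuous functions is
  also required.\<close>

definition exp_orbit :: "('a::euclidean_space \<Rightarrow> 'a) \<Rightarrow> 'a \<Rightarrow> real \<Rightarrow> 'a" where
  "exp_orbit T b t = (\<Sum>k. (t ^ k / fact k) *\<^sub>R (T ^^ k) b)"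

lemma summable_exp_orbit:
  fixes T :: "'a::euclidean_space \<Rightarrow> 'a"
  assumes "bounded_linear T"
  shows "summable (\<lambda>k. (t ^ k / fact k) *\<^sub>R (T ^^ k) b)"
proof -
  obtain C where C: "C > 0" "\<And>x. norm (T x) \<le> norm x * C"
    using bounded_linear.pos_bounded[OF assms] by blast
  have pow: "norm ((T ^^ k) b) \<le> C ^ k * norm b" for k
  proof (induction k)
    case (Suc k)
    have "norm ((T ^^ Suc k) b) \<le> norm ((T ^^ k) b) * C" using C(2) by simp
    also have "\<dots> \<le> (C ^ k * norm b) * C"
      using Suc C(1) by (intro mult_right_mono) auto
    finally show ?case by (simp add: mult_ac)
  qed simp
  show ?thesis
  proof (rule summable_comparison_test')
    show "summable (\<lambda>k. norm b * (inverse (fact k) * (\<bar>t\<bar> * C) ^ k))"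
      by (intro summable_mult summable_exp)
    show "norm ((t ^ k / fact k) *\<^sub>R (T ^^ k) b) \<le> norm b * (inverse (fact k) * (\<bar>t\<bar> * C) ^ k)" if "k \<ge> 0" for k
      using mult_left_mono[OF pow[of k], of "\<bar>t\<bar> ^ k / fact k"]
      by (simp add: power_abs power_mult_distrib field_simps)
  qed
qed

lemma exp_orbit_0 [simp]: "exp_orbit T b 0 = b"
proof -
  have "(\<lambda>k. (0 ^ k / fact k) *\<^sub>R (T ^^ k) b) sums (\<Sum>k\<in>{0}. (0 ^ k / fact k) *\<^sub>R (T ^^ k) b)"
    by (intro sums_finite) auto
  then show ?thesis by (simp add: exp_orbit_def sums_iff)
qed

text \<open>The intertwiner \<open>L\<close> passes through the series term by term. Three instances
  matter: \<open>L = T\<close>, which commutes the operator with its orbit; evaluation of a matrix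
  at a vector, which links the matrix exponential to orbits of vectors; and \<open>snd\<close> on
  the product space.\<close>

lemma exp_orbit_linear:
  assumes "bounded_linear T" "bounded_linear S" "bounded_linear L" "\<And>x. L (T x) = S (L x)"
  shows "L (exp_orbit T b t) = exp_orbit S (L b) t"
proof -
  interpret L: bounded_linear L by fact
  have "L ((T ^^ k) b) = (S ^^ k) (L b)" for k
    by (induction k) (auto simp: assms(4))
  then show ?thesis
    unfolding exp_orbit_def L.suminf[OF summable_exp_orbit[OF assms(1)]]
    by (simp add: L.scaleR)
qed

lemma exp_orbit_has_vector_derivative:
  fixes T :: "'a::euclidean_space \<Rightarrow> 'a"
  assumes T: "bounded_linear T"
  shows "(exp_orbit T b has_vector_derivative T (exp_orbit T b t)) (at t within S)"
proof -
  have comp: "exp_orbit T b t \<bullet> i = (\<Sum>k. (((T ^^ k) b \<bullet> i) / fact k) * t ^ k)" for b i t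
    unfolding exp_orbit_def bounded_linear.suminf[OF bounded_linear_inner_left summable_exp_orbit[OF T]]
    by (simp add: mult_ac)
  have D: "((\<lambda>t. exp_orbit T b t \<bullet> i) has_field_derivative exp_orbit T (T b) t \<bullet> i) (at t)" for i
  proof -
    let ?c = "\<lambda>k. ((T ^^ k) b \<bullet> i) / fact k"
    have "summable (\<lambda>k. ?c k * y ^ k)" for y
      using bounded_linear.summable[OF bounded_linear_inner_left summable_exp_orbit[OF T, of y b], of i]
      by (simp add: mult_ac)
    then have "((\<lambda>t. \<Sum>k. ?c k * t ^ k) has_field_derivative (\<Sum>k. diffs ?c k * t ^ k)) (at t)"
      by (rule termdiffs_strong_converges_everywhere)
    \<comment> \<open>Differentiation cancels one factor of the factorial and leaves one more
      application of \<open>T\<close>, absorbed into the base point: the derivative is the orbit of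
      \<open>T b\<close>.\<close>
    moreover have "diffs ?c = (\<lambda>k. ((T ^^ k) (T b) \<bullet> i) / fact k)"
      by (simp add: diffs_def fun_eq_iff funpow_swap1 del: of_nat_Suc)
    ultimately show ?thesis by (simp add: comp)
  qed
  have "T (exp_orbit T b t) = exp_orbit T (T b) t"
    by (rule exp_orbit_linear) (auto simp: T)
  then have "(exp_orbit T b has_vector_derivative T (exp_orbit T b t)) (at t)"
    unfolding has_vector_derivative_def
    by (subst has_derivative_componentwise_within)
      (use D in \<open>auto simp: has_field_derivative_def mult_commute_abs\<close>)
  then show ?thesis by (rule has_vector_derivative_at_within)
qed

text \<open>The exponential series is itself an orbit, of left multiplication by \<open>M\<close> on
  the space of matrices, starting at \<open>mat 1\<close>. Evaluation at \<open>b\<close>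
  intertwines left multiplication with the action on vectors.\<close>

lemma mat_exp_vector:
  fixes M :: "real^'n^'n"
  shows "mat_exp (t *\<^sub>R M) *v b = exp_orbit ((*v) M) b t"
proof -
  have pow: "((**) (t *\<^sub>R M) ^^ k) X = t ^ k *\<^sub>R (((**) M) ^^ k) X" for k and X :: "real^'n^'n"
    by (induction k) (auto simp: matrix_scalar_ac scalar_matrix_assoc[symmetric] mult.commute)
  have blM: "bounded_linear (\<lambda>X::real^'n^'n. M ** X)"
    by (intro linear_conv_bounded_linear[THEN iffD1] linearI)
      (auto simp: matrix_add_ldistrib matrix_scalar_ac scalar_matrix_assoc[symmetric])
  have blv: "bounded_linear (\<lambda>X::real^'n^'n. X *v b)"
    by (intro linear_conv_bounded_linear[THEN iffD1] linearI)
      (auto simp: matrix_vector_mult_add_rdistrib scaleR_matrix_vector_assoc)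
  have "mat_exp (t *\<^sub>R M) = exp_orbit ((**) M) (mat 1) t"
    by (simp add: mat_exp_def exp_orbit_def pow)
  then show ?thesis
    using exp_orbit_linear[OF blM _ blv, of "(*v) M" "mat 1" t]
    by (simp add: matrix_vector_mul_assoc)
qed

lemma state_initial: "state A B K 0 = B *v vec 1"
  unfolding state_def mat_exp_vector by simp

lemma state_ode:
  "(state A B K has_vector_derivative (A + B ** K) *v state A B K t) (at t within S)"
  unfolding state_def mat_exp_vector
  by (rule exp_orbit_has_vector_derivative) simp

text \<open>Variation of constants: the response of the linear system to a signal that itself solves a
  linear system is read off the triangular system on the product space.\<close>

lemma driven_response_exists:
  fixes M :: "real^'n^'n" and E :: "real^'n^'n"
  obtains y where "y 0 = 0"
    and "\<And>t S. (y has_vector_derivative M *v y t + E *v exp_orbit ((*v) M) b t) (at t within S)"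
proof -
  define T where "T = (\<lambda>p::(real^'n) \<times> (real^'n). (M *v fst p + E *v snd p, M *v snd p))"
  have T: "bounded_linear T"
    unfolding T_def
    by (intro bounded_linear_Pair bounded_linear_add
        bounded_linear_compose[OF matrix_vector_mul_bounded_linear] bounded_linear_fst bounded_linear_snd)
  define p where "p = exp_orbit T (0, b)"
  have d: "(p has_vector_derivative T (p t)) (at t within S)" for t S
    unfolding p_def by (rule exp_orbit_has_vector_derivative[OF T])
  have s: "snd (p t) = exp_orbit ((*v) M) b t" for t
    unfolding p_def by (subst exp_orbit_linear[OF T, of "(*v) M"])
      (auto simp: T_def intro: bounded_linear_snd)
  show thesis
  proof
    show "fst (p 0) = 0" by (simp add: p_def)
    show "((\<lambda>t. fst (p t)) has_vector_derivative M *v fst (p t) + E *v exp_orbit ((*v) M) b t) (at t within S)" for t S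
      using bounded_linear.has_vector_derivative[OF bounded_linear_fst d, of t S] by (simp add: T_def s)
  qed
qed

section \<open>Exponential decay for Hurwitz matrices\<close>

text \<open>Multiplied by the integrating factor \<open>exp (- l * s)\<close>, \<open>g\<close> has
  a derivative of size at most \<open>D * exp (k * s)\<close> with \<open>k = - b - Re l\<close>. As
  \<open>k > 0\<close>, this integrates to at most \<open>D / k * exp (k * t)\<close>, and undoing
  the factor returns exactly the rate \<open>b\<close>.\<close>

lemma scalar_decay:
  fixes g z :: "real \<Rightarrow> complex"
  assumes deriv: "\<And>t. t \<in> {0..T} \<Longrightarrow> (g has_vector_derivative l * g t + z t) (at t within {0..T})"
    and z: "\<And>t. t \<in> {0..T} \<Longrightarrow> norm (z t) \<le> D * exp (- b * t)"
    and l: "Re l < - b" and t: "t \<in> {0..T}"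
  shows "norm (g t) \<le> (norm (g 0) + D / (- b - Re l)) * exp (- b * t)"
proof (cases "t = 0")
  case True
  have "0 \<le> norm (z 0)" by simp
  also have "\<dots> \<le> D" using z[of 0] t by simp
  finally show ?thesis using l True by (simp add: divide_nonneg_neg)
next
  case False
  with t have t0: "0 < t" "t \<le> T" by auto
  have "0 \<le> norm (z 0)" by simp
  also have "\<dots> \<le> D" using z[of 0] t by simp
  finally have D: "0 \<le> D" .
  define k where "k = - b - Re l"
  have k: "k > 0" using l by (simp add: k_def)
  define h where "h s = exp (s *\<^sub>R (- l)) * g s" for s
  have h': "(h has_vector_derivative exp (s *\<^sub>R (- l)) * z s) (at s within {0..T})" if "s \<in> {0..T}" for s
  proof -
    have "(h has_vector_derivative exp (s *\<^sub>R (- l)) * (l * g s + z s) + exp (s *\<^sub>R (- l)) * (- l) * g s)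
        (at s within {0..T})"
      unfolding h_def
      by (intro has_vector_derivative_mult exp_scaleR_has_vector_derivative_right deriv that)
    then show ?thesis by (simp add: algebra_simps)
  qed
  have nexp: "norm (exp (s *\<^sub>R (- l))) = exp (- s * Re l)" for s
    by (simp add: norm_exp_eq_Re)
  have "norm (h t - h 0) \<le> D / k * exp (k * t) - D / k * exp (k * 0)"
  proof (rule differentiable_bound_general[OF t0(1), where \<phi>' = "\<lambda>s. D * exp (k * s)"])
    have "continuous_on {0..T} h"
      using h' by (meson continuous_on_eq_continuous_within has_vector_derivative_continuous)
    then show "continuous_on {0..t} h"
      by (rule continuous_on_subset) (use t0 in auto)
    show "continuous_on {0..t} (\<lambda>s. D / k * exp (k * s))"
      by (intro continuous_intros)
    fix s assume s: "0 < s" "s < t"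
    then have "s \<in> interior {0..T}" using t0 by simp
    moreover have "(h has_vector_derivative exp (s *\<^sub>R (- l)) * z s) (at s within {0..T})"
      by (rule h') (use s t0 in auto)
    ultimately show "(h has_vector_derivative exp (s *\<^sub>R (- l)) * z s) (at s)"
      by (simp only: at_within_interior)
    show "((\<lambda>s. D / k * exp (k * s)) has_vector_derivative D * exp (k * s)) (at s)"
      unfolding has_real_derivative_iff_has_vector_derivative[symmetric]
      using k by (auto intro!: derivative_eq_intros)
    have "norm (exp (s *\<^sub>R (- l)) * z s) \<le> exp (- s * Re l) * (D * exp (- b * s))"
      unfolding norm_mult nexp using z[of s] s t0 by (intro mult_left_mono) auto
    also have "\<dots> = D * exp (k * s)"
      by (simp add: k_def exp_add[symmetric] algebra_simps)
    finally show "norm (exp (s *\<^sub>R (- l)) * z s) \<le> D * exp (k * s)" .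
  qed
  also have "\<dots> \<le> D / k * exp (k * t)" using D k by simp
  finally have "norm (h t) \<le> norm (g 0) + D / k * exp (k * t)"
    using norm_triangle_ineq2[of "h t" "h 0"] by (simp add: h_def)
  then have "exp (Re l * t) * norm (h t) \<le> exp (Re l * t) * (norm (g 0) + D / k * exp (k * t))"
    by (intro mult_left_mono) auto
  also have "exp (Re l * t) * norm (h t) = norm (g t)"
    unfolding h_def norm_mult nexp by (simp add: mult.assoc[symmetric] exp_add[symmetric])
  also have "exp (Re l * t) * (norm (g 0) + D / k * exp (k * t))
      = norm (g 0) * exp (Re l * t) + D / k * exp (- b * t)"
    by (simp add: k_def algebra_simps exp_add[symmetric])
  also have "\<dots> \<le> norm (g 0) * exp (- b * t) + D / k * exp (- b * t)"
    using mult_right_mono[of "Re l" "- b" t] l t0 by (intro add_right_mono mult_left_mono) auto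
  finally show ?thesis by (simp add: k_def algebra_simps)
qed

section \<open>Products of the operators \<open>M - l I\<close> and decay on their kernels\<close>

definition shift_op :: "complex^'n^'n \<Rightarrow> complex \<Rightarrow> complex^'n \<Rightarrow> complex^'n" where
  "shift_op M l v = M *v v - l *s v"

lemma scalar_mult_scaleR: "l *s (c *\<^sub>R v) = c *\<^sub>R (l *s v)" for v :: "complex^'n"
  by (simp add: vec_eq_iff scaleR_conv_of_real mult_ac)

lemma shift_op_linear: "linear (shift_op M l)"
  by (intro linearI)
    (simp_all add: shift_op_def matrix_vector_right_distrib linear_cmul[OF matrix_vector_mul_linear]
      scalar_mult_scaleR vector_add_ldistrib scaleR_diff_right)

lemma shift_op_commute: "shift_op M l (M *v v) = M *v shift_op M l v"
  by (simp add: shift_op_def matrix_vector_mult_diff_distrib vector_scalar_commute)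

text \<open>The constant \<open>C\<close> is uniform in the interval, the solution, the forcing and
  \<open>D\<close>. Bounded intervals are used because in \<open>perturbed_decay\<close> the forcing
  depends on the solution and is bounded only up to a finite time. The set \<open>V\<close> serves
  the induction in \<open>annihilated_decay\<close>, where it is a kernel.\<close>

definition decay_constant :: "('a::real_normed_vector \<Rightarrow> 'a) \<Rightarrow> real \<Rightarrow> 'a set \<Rightarrow> real \<Rightarrow> bool" where
  "decay_constant F b V C \<longleftrightarrow> C \<ge> 0 \<and> (\<forall>T w z D.
     (\<forall>t\<in>{0..T}. (w has_vector_derivative F (w t) + z t) (at t within {0..T})) \<longrightarrow>
     (\<forall>t\<in>{0..T}. w t \<in> V) \<longrightarrow>
     (\<forall>t\<in>{0..T}. norm (z t) \<le> D * exp (- b * t)) \<longrightarrow>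
     (\<forall>t\<in>{0..T}. norm (w t) \<le> C * (norm (w 0) + D) * exp (- b * t)))"

lemma decay_constantI:
  assumes "C \<ge> 0"
    and "\<And>T w z D t. \<lbrakk>\<forall>t\<in>{0..T}. (w has_vector_derivative F (w t) + z t) (at t within {0..T});
      \<forall>t\<in>{0..T}. w t \<in> V; \<forall>t\<in>{0..T}. norm (z t) \<le> D * exp (- b * t); t \<in> {0..T}\<rbrakk> \<Longrightarrow>
      norm (w t) \<le> C * (norm (w 0) + D) * exp (- b * t)"
  shows "decay_constant F b V C"
  unfolding decay_constant_def
  by (rule conjI[OF assms(1)]) (intro allI impI ballI, erule (3) assms(2))

lemma decay_constantD:
  assumes "decay_constant F b V C"
    and "\<forall>t\<in>{0..T}. (w has_vector_derivative F (w t) + z t) (at t within {0..T})"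
    and "\<forall>t\<in>{0..T}. w t \<in> V" and "\<forall>t\<in>{0..T}. norm (z t) \<le> D * exp (- b * t)"
    and "t \<in> {0..T}"
  shows "norm (w t) \<le> C * (norm (w 0) + D) * exp (- b * t)"
  using assms(1)[unfolded decay_constant_def, THEN conjunct2, THEN spec, THEN spec, THEN spec, THEN spec,
      THEN mp, THEN mp, THEN mp, THEN bspec, OF assms(2-5)] .

text \<open>Put \<open>N = shift_op M l\<close>. As \<open>N\<close> commutes with \<open>M\<close>,
  the signal \<open>N w\<close> solves the same system with forcing \<open>N z\<close> and lies in
  the kernel of the shorter product, so the induction hypothesis bounds it at rate \<open>b\<close>.
  It remains to recover \<open>w\<close> from \<open>N w\<close>.\<close>

lemma annihilated_decay:
  fixes M :: "complex^'n^'n"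
  assumes "\<And>l. l \<in> set ls \<Longrightarrow> eigenvalue M l \<Longrightarrow> Re l < - b"
  shows "\<exists>C. decay_constant ((*v) M) b {v. fold (shift_op M) ls v = 0} C"
  using assms
proof (induction ls)
  case Nil
  show ?case by (intro exI[of _ 0] decay_constantI) auto
next
  case (Cons l ls)
  let ?N = "shift_op M l"
  have N: "bounded_linear ?N"
    using shift_op_linear linear_conv_bounded_linear by blast
  obtain P where P: "P > 0" "\<And>v. norm (?N v) \<le> P * norm v"
    using bounded_linear.pos_bounded[OF N] by (metis mult.commute)
  obtain C where dec: "decay_constant ((*v) M) b {v. fold (shift_op M) ls v = 0} C"
    using Cons.IH Cons.prems by auto
  have C: "C \<ge> 0" using dec by (simp add: decay_constant_def)
  have step: "norm (?N (w t)) \<le> C * P * (norm (w 0) + D) * exp (- b * t)"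
    if w: "\<forall>t\<in>{0..T}. (w has_vector_derivative M *v w t + z t) (at t within {0..T})"
      and f: "\<forall>t\<in>{0..T}. w t \<in> {v. fold (shift_op M) (l # ls) v = 0}"
      and z: "\<forall>t\<in>{0..T}. norm (z t) \<le> D * exp (- b * t)" and t: "t \<in> {0..T}" for T w z D t
  proof -
    have "norm (?N (w t)) \<le> C * (norm (?N (w 0)) + P * D) * exp (- b * t)"
    proof (rule decay_constantD[OF dec, where z = "\<lambda>t. ?N (z t)" and T = T])
      show "\<forall>t\<in>{0..T}. ((\<lambda>t. ?N (w t)) has_vector_derivative M *v ?N (w t) + ?N (z t)) (at t within {0..T})"
        using bounded_linear.has_vector_derivative[OF N] w
        by (fastforce simp: linear_add[OF shift_op_linear] shift_op_commute)
      show "\<forall>t\<in>{0..T}. ?N (w t) \<in> {v. fold (shift_op M) ls v = 0}" using f by simp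
      show "\<forall>t\<in>{0..T}. norm (?N (z t)) \<le> P * D * exp (- b * t)"
      proof
        fix t assume "t \<in> {0..T}"
        then have "P * norm (z t) \<le> P * (D * exp (- b * t))"
          using z P(1) by (intro mult_left_mono) auto
        then show "norm (?N (z t)) \<le> P * D * exp (- b * t)"
          using P(2)[of "z t"] by (simp add: mult.assoc)
      qed
    qed (rule t)
    also have "\<dots> \<le> C * (P * norm (w 0) + P * D) * exp (- b * t)"
      using C P(2)[of "w 0"] by (intro mult_left_mono mult_right_mono add_right_mono) auto
    finally show ?thesis by (simp add: algebra_simps)
  qed
  show ?case
  proof (cases "eigenvalue M l")
    \<comment> \<open>Since \<open>M w = l w + N w\<close>, each coordinate of \<open>w\<close>
      solves a scalar equation with forcing \<open>N w + z\<close>.\<close>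
    case True
    with Cons.prems have l: "Re l < - b" by simp
    define k where "k = - b - Re l"
    have k: "k > 0" using l by (simp add: k_def)
    \<comment> \<open>The forcing is at most \<open>(C * P + 1) * (norm (w 0) + D)\<close> times the
      exponential; the leading 1 accounts for the initial value, and \<open>CARD('n)\<close> for the
      passage from coordinates to the norm.\<close>
    define C' where "C' = real CARD('n) * (1 + (C * P + 1) / k)"
    show ?thesis
    proof (intro exI[of _ "C'"] decay_constantI)
      show "C' \<ge> 0" using C P k by (simp add: C'_def)
      fix T w z D t
      assume w: "\<forall>t\<in>{0..T}. (w has_vector_derivative M *v w t + z t) (at t within {0..T})"
        and f: "\<forall>t\<in>{0..T}. w t \<in> {v. fold (shift_op M) (l # ls) v = 0}"
        and z: "\<forall>t\<in>{0..T}. norm (z t) \<le> D * exp (- b * t)" and t: "t \<in> {0..T}"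
      have "0 \<le> norm (z 0)" by simp
      also have "\<dots> \<le> D" using z[rule_format, of 0] t by simp
      finally have D: "0 \<le> D" .
      have "norm (w t $ i) \<le> (1 + (C * P + 1) / k) * (norm (w 0) + D) * exp (- b * t)" for i
      proof -
        have "norm (w t $ i) \<le> (norm (w 0 $ i) + (C * P * (norm (w 0) + D) + D) / (- b - Re l)) * exp (- b * t)"
        proof (rule scalar_decay[OF _ _ l t, where z = "\<lambda>t. ?N (w t) $ i + z t $ i"])
          fix s assume s: "s \<in> {0..T}"
          show "((\<lambda>t. w t $ i) has_vector_derivative l * w s $ i + (?N (w s) $ i + z s $ i)) (at s within {0..T})"
            using bounded_linear.has_vector_derivative[OF bounded_linear_vec_nth w[rule_format, OF s], of i]
            by (simp add: shift_op_def)
          have "norm (?N (w s) $ i + z s $ i) \<le> norm (?N (w s)) + norm (z s)"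
            by (intro norm_triangle_mono Finite_Cartesian_Product.norm_nth_le)
          also have "\<dots> \<le> C * P * (norm (w 0) + D) * exp (- b * s) + D * exp (- b * s)"
            using z s by (intro add_mono step[OF w f z s]) auto
          finally show "norm (?N (w s) $ i + z s $ i) \<le> (C * P * (norm (w 0) + D) + D) * exp (- b * s)"
            by (simp add: algebra_simps)
        qed
        also have "\<dots> \<le> ((norm (w 0) + D) + (C * P * (norm (w 0) + D) + (norm (w 0) + D)) / k) * exp (- b * t)"
          unfolding k_def[symmetric] using D k C P(1)
          by (intro mult_right_mono add_mono divide_right_mono order_trans[OF Finite_Cartesian_Product.norm_nth_le]) auto
        also have "\<dots> = (1 + (C * P + 1) / k) * (norm (w 0) + D) * exp (- b * t)"
          by (simp add: algebra_simps add_divide_distrib)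
        finally show ?thesis .
      qed
      moreover have "norm (w t) \<le> (\<Sum>i\<in>UNIV. norm (w t $ i))"
        unfolding norm_vec_def by (rule L2_set_le_sum) simp
      ultimately have "norm (w t) \<le> (\<Sum>i\<in>(UNIV::'n set). (1 + (C * P + 1) / k) * (norm (w 0) + D) * exp (- b * t))"
        by (meson order_trans sum_mono)
      then show "norm (w t) \<le> C' * (norm (w 0) + D) * exp (- b * t)" by (simp add: C'_def mult_ac)
    qed
  next
    \<comment> \<open>The hypothesis says nothing about \<open>Re l\<close> here. Instead
      \<open>N\<close> is injective, hence bounded below in finite dimension, and the bound on
      \<open>N w\<close> transfers to \<open>w\<close>.\<close>
    case False
    have "inj ?N"
    proof (subst linear_injective_0[OF shift_op_linear], intro allI impI)
      fix v assume "?N v = 0"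
      then show "v = 0" using False by (auto simp: eigenvalue_def shift_op_def)
    qed
    then obtain B where B: "B > 0" "\<And>v. B * norm v \<le> norm (?N v)"
      using linear_inj_bounded_below_pos[OF shift_op_linear] by metis
    show ?thesis
    proof (intro exI[of _ "C * P / B"] decay_constantI)
      show "C * P / B \<ge> 0" using C P B by simp
      fix T w z D t
      assume w: "\<forall>t\<in>{0..T}. (w has_vector_derivative M *v w t + z t) (at t within {0..T})"
        and f: "\<forall>t\<in>{0..T}. w t \<in> {v. fold (shift_op M) (l # ls) v = 0}"
        and z: "\<forall>t\<in>{0..T}. norm (z t) \<le> D * exp (- b * t)" and t: "t \<in> {0..T}"
      show "norm (w t) \<le> C * P / B * (norm (w 0) + D) * exp (- b * t)"
        using order_trans[OF B(2) step[OF w f z t]] B(1) by (simp add: field_simps)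
    qed
  qed
qed

section \<open>Polynomials in a matrix, evaluated on vectors by Horner's scheme\<close>

definition mat_poly :: "complex^'n^'n \<Rightarrow> complex poly \<Rightarrow> complex^'n \<Rightarrow> complex^'n" where
  "mat_poly M p v = fold_coeffs (\<lambda>a w. a *s v + M *v w) p 0"

lemma mat_poly_0 [simp]: "mat_poly M 0 v = 0"
  by (simp add: mat_poly_def)

lemma mat_poly_pCons [simp]: "mat_poly M (pCons a p) v = a *s v + M *v mat_poly M p v"
  by (cases "a = 0 \<and> p = 0") (auto simp: mat_poly_def)

lemma mat_poly_add: "mat_poly M (p + q) v = mat_poly M p v + mat_poly M q v"
  by (induction p q rule: poly_induct2)
    (auto simp: matrix_vector_right_distrib vector_sadd_rdistrib)

lemma mat_poly_smult: "mat_poly M (smult c p) v = c *s mat_poly M p v"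
  by (induction p) (auto simp: vector_add_ldistrib vector_smult_assoc vector_scalar_commute)

lemma mat_poly_monom: "mat_poly M (monom c k) v = c *s ((((**) M) ^^ k) (mat 1) *v v)"
  by (induction k) (auto simp: monom_Suc monom_0 matrix_vector_mul_assoc[symmetric] vector_scalar_commute)

lemma mat_poly_sum: "mat_poly M (sum f S) v = (\<Sum>k\<in>S. mat_poly M (f k) v)"
  by (induction S rule: infinite_finite_induct) (auto simp: mat_poly_add)

text \<open>Each linear factor acts as one shift. The head of the list is the outermost factor,
  applied last, whereas \<open>fold\<close> applies the head first; hence
  \<open>rev\<close>.\<close>

lemma mat_poly_linear_factors:
  "mat_poly M (prod_list (map (\<lambda>l. [:- l, 1:]) ls)) v = fold (shift_op M) (rev ls) v"
proof (induction ls)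
  case Nil
  show ?case by (simp add: one_pCons)
next
  case (Cons l ls)
  have "[:- l, 1:] * q = smult (- l) q + pCons 0 q" for q :: "complex poly"
    by simp
  then show ?case
    by (simp only: list.map prod_list.Cons mat_poly_add mat_poly_smult mat_poly_pCons Cons.IH)
      (simp add: shift_op_def[of M l] vector_sneg_minus1[symmetric])
qed

text \<open>The powers of \<open>M\<close> up to the dimension of the matrix space are too many to
  be linearly independent, and a relation among them supplies the coefficients. \<open>DIM\<close>
  is the real dimension, so these come out real.\<close>

lemma annihilating_poly:
  fixes M :: "complex^'n^'n"
  obtains p where "p \<noteq> 0" "\<And>v. mat_poly M p v = 0"
proof -
  define f where "f k = (((**) M) ^^ k) (mat 1)" for k
  let ?N = "DIM(complex^'n^'n)"
  show thesis
  \<comment> \<open>Dependence speaks of a set of matrices, so a repeated power is split off; it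
    gives the difference of two monomials directly.\<close>
  proof (cases "inj_on f {..?N}")
    case False
    then obtain i j where ij: "i \<noteq> j" "f i = f j" by (auto simp: inj_on_def)
    show thesis
    proof
      have "coeff (monom 1 i + smult (- 1) (monom 1 j)) i = (1 :: complex)" using ij by simp
      then show "monom 1 i + smult (- 1) (monom 1 j) \<noteq> (0 :: complex poly)"
        by (metis coeff_0 zero_neq_one)
      show "mat_poly M (monom 1 i + smult (- 1) (monom 1 j)) v = 0" for v
        unfolding mat_poly_add mat_poly_smult mat_poly_monom
        using ij(2) by (simp add: f_def)
    qed
  next
    case True
    then have "card (f ` {..?N}) = Suc ?N" by (simp add: card_image)
    then have "dependent (f ` {..?N})"
      by (intro dependent_biggerset) auto
    then obtain u where u: "\<exists>X\<in>f ` {..?N}. u X \<noteq> 0" "(\<Sum>X\<in>f ` {..?N}. u X *\<^sub>R X) = 0"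
      using real_vector.dependent_finite[of "f ` {..?N}"] by auto
    define p where "p = (\<Sum>k\<le>?N. monom (complex_of_real (u (f k))) k)"
    show thesis
    proof
      from u(1) obtain k where k: "k \<le> ?N" "u (f k) \<noteq> 0" by auto
      then have "coeff p k \<noteq> 0" by (simp add: p_def coeff_sum)
      then show "p \<noteq> 0" by auto
      fix v
      have scaleR: "(c *\<^sub>R X) *v v = complex_of_real c *s (X *v v)" for c and X :: "complex^'n^'n"
        by (simp add: vec_eq_iff matrix_vector_mult_def scaleR_conv_of_real[where 'a = complex]
            sum_distrib_left mult.assoc)
      have "0 = (\<Sum>X\<in>f ` {..?N}. u X *\<^sub>R X) *v v" by (simp only: u(2) matrix_vector_mult_0)
      also have "(\<Sum>X\<in>f ` {..?N}. u X *\<^sub>R X) = (\<Sum>k\<le>?N. u (f k) *\<^sub>R f k)"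
        by (rule sum.reindex[OF True, unfolded o_def])
      also have "(\<Sum>k\<le>?N. u (f k) *\<^sub>R f k) *v v = (\<Sum>k\<le>?N. complex_of_real (u (f k)) *s (f k *v v))"
        by (induction rule: finite_induct[OF finite_atMost])
          (simp_all add: matrix_vector_mult_add_rdistrib scaleR)
      also have "\<dots> = mat_poly M p v"
        by (simp add: p_def mat_poly_sum mat_poly_monom f_def)
      finally show "mat_poly M p v = 0" by simp
    qed
  qed
qed

text \<open>An annihilating polynomial splits into linear factors over the complex numbers, and its
  nonzero leading coefficient cancels. The roots in \<open>ls\<close> may fail to be eigenvalues of
  \<open>M\<close>, whence the case distinction in \<open>annihilated_decay\<close>.\<close>

lemma annihilating_shifts:
  fixes M :: "complex^'n^'n"
  obtains ls where "\<And>v. fold (shift_op M) ls v = 0"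
proof -
  obtain p where p: "p \<noteq> 0" "\<And>v. mat_poly M p v = 0" by (rule annihilating_poly[of M]) blast
  obtain R where R: "p = smult (lead_coeff p) (\<Prod>x\<in>#R. [:-x, 1:])"
    using alg_closed_imp_factorization[OF p(1)] by blast
  obtain ls where ls: "R = mset ls" by (metis ex_mset)
  have "p = smult (lead_coeff p) (prod_list (map (\<lambda>l. [:- l, 1:]) ls))"
    using R unfolding ls by (simp add: prod_mset_prod_list flip: mset_map)
  then have "mat_poly M p v = lead_coeff p *s fold (shift_op M) (rev ls) v" for v
    by (metis mat_poly_smult mat_poly_linear_factors)
  then have "fold (shift_op M) (rev ls) v = 0" for v
    using p by (simp add: vector_mul_eq_0)
  then show thesis by (rule that)
qed

section \<open>Transfer of the estimate from complex to real systems\<close>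

definition complex_vec :: "real^'n \<Rightarrow> complex^'n" where
  "complex_vec v = (\<chi> i. complex_of_real (v $ i))"

lemma complex_vec_bounded_linear: "bounded_linear (complex_vec :: real^'n \<Rightarrow> complex^'n)"
  unfolding linear_conv_bounded_linear[symmetric]
  by (intro linearI) (auto simp: complex_vec_def vec_eq_iff scaleR_conv_of_real[where 'a = complex])

text \<open>Being isometric, the embedding passes the constant \<open>C\<close> unchanged from the
  complex system to the real one.\<close>

lemma norm_complex_vec [simp]: "norm (complex_vec v) = norm v"
  by (simp add: complex_vec_def norm_vec_def)

lemma complex_vec_mult: "complex_vec (M *v v) = complex_mat M *v complex_vec v"
  by (simp add: complex_vec_def complex_mat_def vec_eq_iff matrix_vector_mult_def)

lemma hurwitz_decay:
  fixes M :: "real^'n^'n"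
  assumes "hurwitz M"
  obtains b C where "b > 0" "decay_constant ((*v) M) b UNIV C"
proof -
  let ?M = "complex_mat M"
  obtain ls where ls: "\<And>v. fold (shift_op ?M) ls v = 0" by (rule annihilating_shifts[of ?M]) blast
  \<comment> \<open>Only finitely many eigenvalues occur in \<open>ls\<close>, so their distances
    from the imaginary axis have a positive minimum; the entry 1 keeps \<open>S\<close> nonempty.
    Halving the minimum gives the strict inequality \<open>Re l < - b\<close> required by
    \<open>scalar_decay\<close>.\<close>
  define S where "S = insert 1 ((\<lambda>l. - Re l) ` {l \<in> set ls. eigenvalue ?M l})"
  have S: "finite S" "S \<noteq> {}" by (auto simp: S_def)
  define b where "b = Min S / 2"
  have "Min S \<in> S" using S by (rule Min_in)
  then have b: "b > 0" using assms by (auto simp: b_def S_def hurwitz_def)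
  have evs: "Re l < - b" if "l \<in> set ls" "eigenvalue ?M l" for l
  proof -
    have "Min S \<le> - Re l" using S(1) that by (intro Min_le) (auto simp: S_def)
    then show ?thesis using b by (simp add: b_def)
  qed
  have "\<exists>C. decay_constant ((*v) ?M) b {v. fold (shift_op ?M) ls v = 0} C"
    by (rule annihilated_decay) (rule evs)
  then obtain C where dec: "decay_constant ((*v) ?M) b UNIV C" using ls by auto
  have "decay_constant ((*v) M) b UNIV C"
  proof (rule decay_constantI)
    show "C \<ge> 0" using dec by (simp add: decay_constant_def)
    fix T w z D t
    assume w: "\<forall>t\<in>{0..T}. (w has_vector_derivative M *v w t + z t) (at t within {0..T})"
      and z: "\<forall>t\<in>{0..T}. norm (z t) \<le> D * exp (- b * t)" and t: "t \<in> {0..T}"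
    have "norm (complex_vec (w t)) \<le> C * (norm (complex_vec (w 0)) + D) * exp (- b * t)"
    proof (rule decay_constantD[OF dec, where z = "\<lambda>t. complex_vec (z t)" and w = "\<lambda>t. complex_vec (w t)", OF _ _ _ t])
      show "\<forall>t\<in>{0..T}. ((\<lambda>t. complex_vec (w t)) has_vector_derivative
          ?M *v complex_vec (w t) + complex_vec (z t)) (at t within {0..T})"
        using bounded_linear.has_vector_derivative[OF complex_vec_bounded_linear w[rule_format]]
        by (simp add: linear_add[OF bounded_linear.linear[OF complex_vec_bounded_linear]] complex_vec_mult)
      show "\<forall>t\<in>{0..T}. norm (complex_vec (z t)) \<le> D * exp (- b * t)" using z by simp
    qed simp
    then show "norm (w t) \<le> C * (norm (w 0) + D) * exp (- b * t)" by simp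
  qed
  then show thesis using b that by blast
qed

section \<open>Expansion of the closed-loop state in the gain\<close>

text \<open>The norm of a matrix is the Euclidean norm of its entries; Cauchy-Schwarz is applied to
  each row.\<close>

lemma norm_matrix_vector_mult_le: "norm (X *v v) \<le> norm X * norm v" for X :: "real^'n^'m"
proof -
  have "norm (X *v v) \<le> L2_set (\<lambda>k. norm (X $ k) * norm v) UNIV"
    unfolding norm_vec_def[of "X *v v"]
    by (rule L2_set_mono) (auto simp: matrix_vector_mul_component Cauchy_Schwarz_ineq2)
  also have "\<dots> = norm X * norm v"
    by (simp add: norm_vec_def[of X] L2_set_left_distrib)
  finally show ?thesis .
qed

lemma decay_constant_half_line:
  assumes dec: "decay_constant F b UNIV C"
    and w: "\<And>t. t \<ge> 0 \<Longrightarrow> (w has_vector_derivative F (w t) + z t) (at t)"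
    and z: "\<And>t. t \<ge> 0 \<Longrightarrow> norm (z t) \<le> D * exp (- b * t)" and t: "t \<ge> 0"
  shows "norm (w t) \<le> C * (norm (w 0) + D) * exp (- b * t)"
proof (rule decay_constantD[OF dec, where z = z and T = t])
  show "\<forall>s\<in>{0..t}. (w has_vector_derivative F (w s) + z s) (at s within {0..t})"
    using w by (auto intro: has_vector_derivative_at_within)
qed (use z t in auto)

text \<open>Decay survives a small perturbation at the same rate: at a maximiser \<open>s\<close> of
  \<open>norm (w t) * exp (b * t)\<close> the perturbation contributes at most half of the maximum.\<close>

lemma perturbed_decay:
  assumes dec: "decay_constant F b UNIV C"
    and w: "\<And>t. t \<ge> 0 \<Longrightarrow> (w has_vector_derivative F (w t) + G (w t)) (at t)"
    and G: "\<And>v. norm (G v) \<le> e * norm v" and e: "C * e \<le> 1 / 2" "e \<ge> 0" and t: "t \<ge> 0"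
  shows "norm (w t) \<le> 2 * C * norm (w 0) * exp (- b * t)"
proof -
  define phi where "phi s = norm (w s) * exp (b * s)" for s
  have "continuous_on {0..t} w"
    using w by (meson atLeastAtMost_iff continuous_at_imp_continuous_on has_vector_derivative_continuous)
  then have "continuous_on {0..t} phi"
    unfolding phi_def by (intro continuous_intros)
  then obtain s where s: "s \<in> {0..t}" "\<And>r. r \<in> {0..t} \<Longrightarrow> phi r \<le> phi s"
    using continuous_attains_sup[of "{0..t}" phi] t by auto
  have w_le: "norm (w r) \<le> phi s * exp (- b * r)" if "r \<in> {0..t}" for r
  proof -
    have "norm (w r) = phi r * exp (- b * r)"
      by (simp add: phi_def mult.assoc exp_add[symmetric])
    then show ?thesis using s(2)[OF that] by (simp add: mult_right_mono)
  qed
  \<comment> \<open>By maximality the perturbation is, on all of \<open>{0..t}\<close>, a forcing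
    with \<open>D = e * phi s\<close>. The estimate at \<open>s\<close> becomes
    \<open>phi s \<le> C * norm (w 0) + C * e * phi s\<close>, and absorbing the last term produces
    the factor 2.\<close>
  have "norm (w s) \<le> C * (norm (w 0) + e * phi s) * exp (- b * s)"
  proof (rule decay_constantD[OF dec _ _ _ s(1), where z = "\<lambda>t. G (w t)"])
    show "\<forall>r\<in>{0..t}. (w has_vector_derivative F (w r) + G (w r)) (at r within {0..t})"
      using w by (auto intro: has_vector_derivative_at_within)
    show "\<forall>r\<in>{0..t}. norm (G (w r)) \<le> e * phi s * exp (- b * r)"
    proof
      fix r assume "r \<in> {0..t}"
      then have "e * norm (w r) \<le> e * (phi s * exp (- b * r))"
        using w_le e(2) by (intro mult_left_mono) auto
      then show "norm (G (w r)) \<le> e * phi s * exp (- b * r)"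
        using G[of "w r"] by (simp add: mult.assoc)
    qed
  qed simp
  then have "phi s \<le> C * (norm (w 0) + e * phi s) * exp (- b * s) * exp (b * s)"
    unfolding phi_def by (intro mult_right_mono) auto
  also have "\<dots> = C * norm (w 0) + (C * e) * phi s"
    by (simp add: mult.assoc exp_add[symmetric] distrib_left)
  also have "\<dots> \<le> C * norm (w 0) + (1 / 2) * phi s"
    using e(1) by (intro add_left_mono mult_right_mono) (auto simp: phi_def)
  finally have "phi s \<le> 2 * C * norm (w 0)" by simp
  then have "phi s * exp (- b * t) \<le> 2 * C * norm (w 0) * exp (- b * t)"
    by (rule mult_right_mono) simp
  moreover have "norm (w t) \<le> phi s * exp (- b * t)" using t by (intro w_le) simp
  ultimately show ?thesis by (rule order_trans[rotated])
qed

text \<open>A relation instead of a chosen function, so that additivity and homogeneity in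
  \<open>H\<close> can be verified on the equation itself.\<close>

definition state_variation ::
  "real^'n^'n \<Rightarrow> real^'m^'n \<Rightarrow> real^'n^'m \<Rightarrow> real^'n^'m \<Rightarrow> (real \<Rightarrow> real^'n) \<Rightarrow> bool" where
  "state_variation A B K H y \<longleftrightarrow> y 0 = 0 \<and>
     (\<forall>t. (y has_vector_derivative (A + B ** K) *v y t + (B ** H) *v state A B K t) (at t))"

lemma state_variation_exists: "\<exists>y. state_variation A B K H y"
proof -
  obtain y where "y 0 = 0"
    "\<And>t S. (y has_vector_derivative
      (A + B ** K) *v y t + (B ** H) *v exp_orbit ((*v) (A + B ** K)) (B *v vec 1) t) (at t within S)"
    by (rule driven_response_exists) blast
  then show ?thesis
    by (intro exI[of _ y]) (simp add: state_variation_def state_def[abs_def] mat_exp_vector)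
qed

text \<open>All states start at the same vector, so differences start at zero and are governed by
  their forcing alone. It is \<open>B H x(K + H)\<close> for the difference
  \<open>x(K + H) - x(K)\<close>, \<open>B H x(K)\<close> for \<open>y\<close>, and
  \<open>B H (x(K + H) - x(K))\<close> for the remainder, the last being already of second
  order.\<close>

lemma state_expansion:
  fixes A :: "real^'n^'n" and B :: "real^'m^'n"
  assumes "hurwitz (A + B ** K)"
  obtains b c \<delta> where "b > 0" "c \<ge> 0" "\<delta> > 0"
    and "\<And>H t. norm H < \<delta> \<Longrightarrow> t \<ge> 0 \<Longrightarrow> norm (state A B (K + H) t) \<le> c * exp (- b * t)"
    and "\<And>H y t. state_variation A B K H y \<Longrightarrow> t \<ge> 0 \<Longrightarrow> norm (y t) \<le> c * norm H * exp (- b * t)"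
    and "\<And>H y t. norm H < \<delta> \<Longrightarrow> state_variation A B K H y \<Longrightarrow> t \<ge> 0 \<Longrightarrow>
      norm (state A B (K + H) t - state A B K t - y t) \<le> c * (norm H)\<^sup>2 * exp (- b * t)"
proof -
  let ?M = "A + B ** K"
  obtain b C where b: "b > 0" and dec: "decay_constant ((*v) ?M) b UNIV C"
    using hurwitz_decay[OF assms] by blast
  have C: "C \<ge> 0" using dec by (simp add: decay_constant_def)
  define X where "X = norm (B *v vec 1 :: real^'n)"
  define \<beta> where "\<beta> = norm B"
  have X: "X \<ge> 0" and \<beta>: "\<beta> \<ge> 0" by (auto simp: X_def \<beta>_def)
  \<comment> \<open>The 2 comes from \<open>perturbed_decay\<close>. Each later stage uses the
    estimate once more with a factor \<open>B H\<close> in the forcing, which multiplies the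
    constant by \<open>C * \<beta>\<close>.\<close>
  define c1 where "c1 = 2 * C * X"
  define c2 where "c2 = C * \<beta> * c1"
  define c3 where "c3 = C * \<beta> * c2"
  have c: "c1 \<ge> 0" "c2 \<ge> 0" "c3 \<ge> 0" using C X \<beta> by (auto simp: c1_def c2_def c3_def)
  \<comment> \<open>Chosen so that \<open>norm H < \<delta>\<close> implies
    \<open>C * (\<beta> * norm H) \<le> 1 / 2\<close>; the added 1 avoids a zero
    denominator.\<close>
  define \<delta> where "\<delta> = 1 / (2 * C * \<beta> + 1)"
  have pos: "2 * C * \<beta> + 1 > 0" using C \<beta> by (intro add_nonneg_pos) auto
  then have \<delta>: "\<delta> > 0" by (simp add: \<delta>_def)
  have BH: "norm ((B ** H) *v v) \<le> \<beta> * norm H * norm v" for H :: "real^'n^'m" and v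
  proof -
    have "norm ((B ** H) *v v) \<le> \<beta> * norm (H *v v)"
      unfolding \<beta>_def matrix_vector_mul_assoc[symmetric] by (rule norm_matrix_vector_mult_le)
    also have "\<dots> \<le> \<beta> * (norm H * norm v)"
      using \<beta> by (intro mult_left_mono norm_matrix_vector_mult_le)
    finally show ?thesis by (simp add: mult.assoc)
  qed
  have BH_le: "norm ((B ** H) *v v) \<le> \<beta> * norm H * D * exp (- b * t)"
    if "norm v \<le> D * exp (- b * t)" for H :: "real^'n^'m" and v D t
    using order_trans[OF BH mult_left_mono[OF that]] \<beta> by (simp add: mult.assoc)
  have state': "(state A B (K + H) has_vector_derivative
      ?M *v state A B (K + H) t + (B ** H) *v state A B (K + H) t) (at t)" for H t
    using state_ode[of A B "K + H" t UNIV]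
    by (simp add: matrix_add_ldistrib matrix_vector_mult_add_rdistrib add.assoc)
  have x: "norm (state A B (K + H) t) \<le> c1 * exp (- b * t)" if "norm H < \<delta>" "t \<ge> 0" for H t
  proof -
    have "norm (state A B (K + H) t) \<le> 2 * C * norm (state A B (K + H) 0) * exp (- b * t)"
    proof (rule perturbed_decay[OF dec state' BH])
      have "norm H * (2 * C * \<beta> + 1) < 1"
        using that(1) pos by (simp add: \<delta>_def pos_less_divide_eq)
      then have "2 * (C * \<beta> * norm H) + norm H < 1" by (simp add: algebra_simps)
      then have "2 * (C * \<beta> * norm H) \<le> 1" using norm_ge_zero[of H] by linarith
      then show "C * (\<beta> * norm H) \<le> 1 / 2" by (simp add: mult.assoc)
    qed (use \<beta> that in auto)
    then show ?thesis by (simp add: state_initial c1_def X_def)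
  qed
  have x0: "norm (state A B K t) \<le> c1 * exp (- b * t)" if "t \<ge> 0" for t
    using x[of 0 t] \<delta> that by simp
  have y: "norm (y t) \<le> c2 * norm H * exp (- b * t)" if y: "state_variation A B K H y" and t: "t \<ge> 0" for H y t
  proof -
    have "norm (y t) \<le> C * (norm (y 0) + \<beta> * norm H * c1) * exp (- b * t)"
      by (rule decay_constant_half_line[OF dec _ BH_le[OF x0] t])
        (use y in \<open>auto simp: state_variation_def\<close>)
    then show ?thesis using y by (simp add: state_variation_def c2_def mult_ac)
  qed
  have d: "norm (state A B (K + H) t - state A B K t) \<le> c2 * norm H * exp (- b * t)"
    if H: "norm H < \<delta>" and t: "t \<ge> 0" for H t
  proof -
    have "norm (state A B (K + H) t - state A B K t)
        \<le> C * (norm (state A B (K + H) 0 - state A B K 0) + \<beta> * norm H * c1) * exp (- b * t)"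
    proof (rule decay_constant_half_line[OF dec _ BH_le[OF x[OF H]] t])
      show "((\<lambda>t. state A B (K + H) t - state A B K t) has_vector_derivative
          ?M *v (state A B (K + H) t - state A B K t) + (B ** H) *v state A B (K + H) t) (at t)" for t
        using has_vector_derivative_diff[OF state'[of H] state_ode[of A B K _ UNIV]]
        by (simp add: matrix_vector_mult_diff_distrib algebra_simps)
    qed
    then show ?thesis by (simp add: state_initial c2_def mult_ac)
  qed
  have r: "norm (state A B (K + H) t - state A B K t - y t) \<le> c3 * (norm H)\<^sup>2 * exp (- b * t)"
    if H: "norm H < \<delta>" and y: "state_variation A B K H y" and t: "t \<ge> 0" for H y t
  proof -
    let ?r = "\<lambda>t. state A B (K + H) t - state A B K t - y t"
    have "norm (?r t) \<le> C * (norm (?r 0) + \<beta> * norm H * (c2 * norm H)) * exp (- b * t)"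
    proof (rule decay_constant_half_line[OF dec _ BH_le[OF d[OF H]] t])
      have y': "(y has_vector_derivative ?M *v y t + (B ** H) *v state A B K t) (at t)" for t
        using y by (simp add: state_variation_def)
      show "(?r has_vector_derivative
          ?M *v ?r t + (B ** H) *v (state A B (K + H) t - state A B K t)) (at t)" for t
        using has_vector_derivative_diff[OF has_vector_derivative_diff[OF state'[of H] state_ode[of A B K _ UNIV]] y']
        by (simp add: matrix_vector_mult_diff_distrib algebra_simps)
    qed
    then show ?thesis
      using y by (simp add: state_variation_def state_initial c3_def power2_eq_square mult_ac)
  qed
  show thesis
  proof
    show "b > 0" "c1 + c2 + c3 \<ge> 0" "\<delta> > 0" using b c \<delta> by auto
    have mono: "u * exp (- b * t) \<le> v * exp (- b * t)" if "u \<le> v" for u v t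
      using that by (rule mult_right_mono) simp
    show "norm (state A B (K + H) t) \<le> (c1 + c2 + c3) * exp (- b * t)" if "norm H < \<delta>" "t \<ge> 0" for H t
      using c by (intro order_trans[OF x[OF that]] mono) auto
    show "norm (y t) \<le> (c1 + c2 + c3) * norm H * exp (- b * t)"
      if "state_variation A B K H y" "t \<ge> 0" for H y t
      using c by (intro order_trans[OF y[OF that]] mono mult_right_mono) auto
    show "norm (state A B (K + H) t - state A B K t - y t) \<le> (c1 + c2 + c3) * (norm H)\<^sup>2 * exp (- b * t)"
      if "norm H < \<delta>" "state_variation A B K H y" "t \<ge> 0" for H y t
      using c by (intro order_trans[OF r[OF that]] mono mult_right_mono) auto
  qed
qed

section \<open>Laplace transforms\<close>

lemma exp_decay_absolutely_integrable:
  fixes f :: "real \<Rightarrow> 'a::euclidean_space"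
  assumes "continuous_on {0..} f" "b > 0" "\<And>t. t \<ge> 0 \<Longrightarrow> norm (f t) \<le> c * exp (- b * t)"
  shows "f absolutely_integrable_on {0..}"
proof (rule measurable_bounded_by_integrable_imp_absolutely_integrable)
  show "f \<in> borel_measurable (lebesgue_on {0..})"
    by (rule continuous_imp_measurable_on_sets_lebesgue) (use assms in auto)
  show "(\<lambda>t. c * exp (- b * t)) integrable_on {0..}"
    using integrable_on_exp_minus_to_infinity[OF assms(2)] by (rule integrable_on_mult_right)
qed (use assms in auto)

lemma integral_tendsto_half_line:
  fixes f :: "real \<Rightarrow> 'a::euclidean_space"
  assumes "f absolutely_integrable_on {0..}"
  shows "((\<lambda>T. integral {0..T} f) \<longlongrightarrow> integral {0..} f) at_top"
proof -
  have "((\<lambda>T. LINT t:{0..T}|lebesgue. f t) \<longlongrightarrow> (LINT t:{0..}|lebesgue. f t)) at_top"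
    by (rule tendsto_set_lebesgue_integral_at_top) (use assms in auto)
  moreover have "(LINT t:{0..T}|lebesgue. f t) = integral {0..T} f" for T
    by (rule set_lebesgue_integral_eq_integral(2), rule set_integrable_subset[OF assms]) auto
  ultimately show ?thesis
    by (simp add: set_lebesgue_integral_eq_integral(2)[OF assms])
qed

definition laplace :: "(real \<Rightarrow> real) \<Rightarrow> complex \<Rightarrow> complex" where
  "laplace f s = integral {0..} (\<lambda>t. exp (- s * complex_of_real t) * complex_of_real (f t))"

lemma laplace_integrand_absolutely_integrable:
  assumes "continuous_on {0..} f" "b > 0" "\<And>t. t \<ge> 0 \<Longrightarrow> \<bar>f t\<bar> \<le> c * exp (- b * t)" "Re s \<ge> 0"
  shows "(\<lambda>t. exp (- s * complex_of_real t) * complex_of_real (f t)) absolutely_integrable_on {0..}"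
proof (rule exp_decay_absolutely_integrable[OF _ assms(2)])
  show "continuous_on {0..} (\<lambda>t. exp (- s * complex_of_real t) * complex_of_real (f t))"
    by (intro continuous_intros assms(1))
  fix t :: real assume t: "t \<ge> 0"
  have "exp (- Re s * t) * \<bar>f t\<bar> \<le> 1 * \<bar>f t\<bar>"
    using t assms(4) by (intro mult_right_mono) auto
  then show "norm (exp (- s * complex_of_real t) * complex_of_real (f t)) \<le> c * exp (- b * t)"
    using assms(3)[OF t] by (simp add: norm_mult norm_exp_eq_Re)
qed

text \<open>The derivative of \<open>exp (- s * t) * f t\<close> is integrated over
  \<open>{0..T}\<close>, and \<open>T\<close> tends to infinity. The boundary term at
  \<open>T\<close> vanishes because \<open>f\<close> decays and \<open>Re s \<ge> 0\<close>; the one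
  at 0 is \<open>- f 0\<close>.\<close>

lemma laplace_derivative:
  assumes f: "\<And>t. t \<ge> 0 \<Longrightarrow> (f has_vector_derivative f' t) (at t)"
    and f': "continuous_on {0..} f'" and b: "b > 0"
    and f_le: "\<And>t. t \<ge> 0 \<Longrightarrow> \<bar>f t\<bar> \<le> c * exp (- b * t)"
    and f'_le: "\<And>t. t \<ge> 0 \<Longrightarrow> \<bar>f' t\<bar> \<le> c' * exp (- b * t)" and s: "Re s \<ge> 0"
  shows "laplace f' s = s * laplace f s - complex_of_real (f 0)"
proof -
  let ?e = "\<lambda>t. exp (- s * complex_of_real t)"
  define F where "F t = ?e t * complex_of_real (f t)" for t
  define g where "g t = ?e t * complex_of_real (f' t) - s * (?e t * complex_of_real (f t))" for t
  have cont: "continuous_on {0..} f"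
    using f by (meson atLeast_iff continuous_at_imp_continuous_on has_vector_derivative_continuous)
  note int = laplace_integrand_absolutely_integrable[OF cont b f_le s]
    laplace_integrand_absolutely_integrable[OF f' b f'_le s]
  have g: "g absolutely_integrable_on {0..}"
    unfolding g_def by (intro set_integral_diff(1) int set_integrable_mult_right)
  have F': "(F has_vector_derivative g t) (at t)" if "t \<ge> 0" for t
  proof -
    have "(?e has_vector_derivative (- s) * ?e t) (at t)"
      using exp_scaleR_has_vector_derivative_left[of "- s" t]
      by (simp add: scaleR_conv_of_real mult.commute)
    moreover have "((\<lambda>t. complex_of_real (f t)) has_vector_derivative complex_of_real (f' t)) (at t)"
      by (rule bounded_linear.has_vector_derivative[OF bounded_linear_of_real f[OF that]])
    ultimately have "(F has_vector_derivative
        ?e t * complex_of_real (f' t) + (- s) * ?e t * complex_of_real (f t)) (at t)"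
      unfolding F_def by (intro has_vector_derivative_mult)
    then show ?thesis by (simp add: g_def mult.assoc)
  qed
  have "((\<lambda>T. integral {0..T} g) \<longlongrightarrow> integral {0..} g) at_top"
    by (rule integral_tendsto_half_line[OF g])
  moreover have "((\<lambda>T. integral {0..T} g) \<longlongrightarrow> - F 0) at_top"
  proof (rule Lim_transform_eventually)
    have "(F \<longlongrightarrow> 0) at_top"
    proof (rule Lim_null_comparison)
      show "\<forall>\<^sub>F t in at_top. norm (F t) \<le> c * exp (- b * t)"
        using eventually_ge_at_top[of 0]
      proof eventually_elim
        case (elim t)
        have "exp (- Re s * t) * \<bar>f t\<bar> \<le> 1 * \<bar>f t\<bar>"
          using elim s by (intro mult_right_mono) auto
        then show ?case
          using f_le[OF elim] by (simp add: F_def norm_mult norm_exp_eq_Re)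
      qed
      have "filterlim (\<lambda>t. - b * t) at_bot at_top"
        using b by (intro filterlim_tendsto_neg_mult_at_bot[OF tendsto_const]) (auto simp: filterlim_ident)
      then show "((\<lambda>t. c * exp (- b * t)) \<longlongrightarrow> 0) at_top"
        by (intro tendsto_mult_right_zero filterlim_compose[OF exp_at_bot])
    qed
    then show "((\<lambda>T. F T - F 0) \<longlongrightarrow> - F 0) at_top"
      by (auto intro!: tendsto_eq_intros)
    show "\<forall>\<^sub>F T in at_top. F T - F 0 = integral {0..T} g"
      using eventually_ge_at_top[of 0]
    proof eventually_elim
      case (elim T)
      have "(g has_integral F T - F 0) {0..T}"
        using elim F' by (intro fundamental_theorem_of_calculus) (auto intro: has_vector_derivative_at_within)
      then show ?case by (simp add: integral_unique)
    qed
  qed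
  ultimately have "integral {0..} g = - F 0"
    by (intro tendsto_unique[OF trivial_limit_at_top_linorder])
  moreover have "integral {0..} g = laplace f' s - s * laplace f s"
    unfolding g_def laplace_def
    using int[THEN set_lebesgue_integral_eq_integral(1)]
    by (subst integral_diff) (auto intro: integrable_on_mult_right)
  ultimately show ?thesis by (simp add: F_def algebra_simps)
qed

lemma laplace_linear_combination:
  assumes "finite J" "b > 0" "\<And>j. j \<in> J \<Longrightarrow> continuous_on {0..} (f j)"
    and "\<And>j t. j \<in> J \<Longrightarrow> t \<ge> 0 \<Longrightarrow> \<bar>f j t\<bar> \<le> c j * exp (- b * t)" and "Re s \<ge> 0"
  shows "laplace (\<lambda>t. \<Sum>j\<in>J. a j * f j t) s = (\<Sum>j\<in>J. complex_of_real (a j) * laplace (f j) s)"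
proof -
  have "(\<lambda>t. exp (- s * complex_of_real t) * complex_of_real (f j t)) integrable_on {0..}" if "j \<in> J" for j
    using laplace_integrand_absolutely_integrable[OF assms(3) assms(2) assms(4) assms(5)] that
    by (intro set_lebesgue_integral_eq_integral(1)) blast
  then have "(\<Sum>j\<in>J. complex_of_real (a j) * laplace (f j) s) = integral {0..}
      (\<lambda>t. \<Sum>j\<in>J. complex_of_real (a j) * (exp (- s * complex_of_real t) * complex_of_real (f j t)))"
    unfolding laplace_def
    by (subst integral_sum) (auto intro: integrable_on_mult_right assms(1))
  then show ?thesis
    by (simp add: laplace_def sum_distrib_left mult_ac)
qed

text \<open>A nonzero kernel vector of \<open>s I - M\<close> would make \<open>s\<close> an
  eigenvalue in the closed right half-plane.\<close>

lemma hurwitz_resolvent_invertible: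
  assumes "hurwitz M" "Re s \<ge> 0"
  shows "matrix_inv (mat s - complex_mat M) ** (mat s - complex_mat M) = mat 1"
proof -
  have "v = 0" if "(mat s - complex_mat M) *v v = 0" for v
  proof (rule ccontr)
    assume "v \<noteq> 0"
    moreover have "mat s *v v = s *s v"
      by (simp add: vec_eq_iff matrix_vector_mult_def mat_def if_distrib if_distribR cong: if_cong)
    ultimately have "eigenvalue (complex_mat M) s"
      using that by (auto simp: eigenvalue_def matrix_vector_mult_diff_rdistrib)
    then show False using assms by (auto simp: hurwitz_def)
  qed
  then have "invertible (mat s - complex_mat M)"
    unfolding invertible_left_inverse matrix_left_invertible_ker by blast
  then show ?thesis
    unfolding invertible_def matrix_inv_def by (metis (mono_tags, lifting) someI_ex)
qed

lemma laplace_ode: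
  fixes M :: "real^'n^'n"
  assumes M: "hurwitz M" and w: "\<And>t. t \<ge> 0 \<Longrightarrow> (w has_vector_derivative M *v w t + z t) (at t)"
    and z: "continuous_on {0..} z" and b: "b > 0"
    and w_le: "\<And>t. t \<ge> 0 \<Longrightarrow> norm (w t) \<le> c * exp (- b * t)"
    and z_le: "\<And>t. t \<ge> 0 \<Longrightarrow> norm (z t) \<le> d * exp (- b * t)" and s: "Re s \<ge> 0"
  shows "(\<chi> i. laplace (\<lambda>t. w t $ i) s) =
    matrix_inv (mat s - complex_mat M) *v (complex_vec (w 0) + (\<chi> i. laplace (\<lambda>t. z t $ i) s))"
proof -
  define W where "W = (\<chi> i. laplace (\<lambda>t. w t $ i) s)"
  define Z where "Z = (\<chi> i. laplace (\<lambda>t. z t $ i) s)"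
  have w_cont: "continuous_on {0..} w"
    using w by (meson atLeast_iff continuous_at_imp_continuous_on has_vector_derivative_continuous)
  have comp_le: "\<bar>v $ i\<bar> \<le> r" if "norm v \<le> r" for v :: "real^'n" and i r
    using component_le_norm_cart[of v i] that by linarith
  have "s * W $ i - complex_of_real (w 0 $ i) = (complex_mat M *v W) $ i + Z $ i" for i
  proof -
    \<comment> \<open>Row \<open>i\<close> of \<open>M w + z\<close> is written as a single finite
      linear combination indexed by \<open>option\<close>: \<open>None\<close> stands for the
      forcing, with coefficient 1, and \<open>Some j\<close> for coordinate \<open>j\<close> of
      \<open>w\<close>.\<close>
    define f where "f j = (case j of None \<Rightarrow> \<lambda>t. z t $ i | Some j \<Rightarrow> \<lambda>t. w t $ j)" for j
    define a where "a j = (case j of None \<Rightarrow> 1 | Some j \<Rightarrow> M $ i $ j)" for j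
    have f: "continuous_on {0..} (f j)" and f_le: "t \<ge> 0 \<Longrightarrow> \<bar>f j t\<bar> \<le> (case j of None \<Rightarrow> d | Some _ \<Rightarrow> c) * exp (- b * t)" for j t
      using comp_le[OF w_le] comp_le[OF z_le]
      by (auto simp: f_def split: option.split intro!: continuous_intros z w_cont)
    have sumf: "(M *v w t + z t) $ i = (\<Sum>j\<in>UNIV. a j * f j t)" for t
      by (simp add: UNIV_option_conv sum.reindex f_def a_def matrix_vector_mult_def add.commute)
    have "laplace (\<lambda>t. \<Sum>j\<in>UNIV. a j * f j t) s = s * laplace (\<lambda>t. w t $ i) s - complex_of_real (w 0 $ i)"
    proof (rule laplace_derivative[OF _ _ b _ _ s])
      show "((\<lambda>t. w t $ i) has_vector_derivative (\<Sum>j\<in>UNIV. a j * f j t)) (at t)" if "t \<ge> 0" for t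
        using bounded_linear.has_vector_derivative[OF bounded_linear_vec_nth w[OF that], of i]
        by (simp only: sumf)
      show "continuous_on {0..} (\<lambda>t. \<Sum>j\<in>UNIV. a j * f j t)"
        by (intro continuous_intros f)
      show "\<bar>w t $ i\<bar> \<le> c * exp (- b * t)" if "t \<ge> 0" for t
        by (rule comp_le[OF w_le[OF that]])
      fix t :: real assume t: "t \<ge> 0"
      have "\<bar>\<Sum>j\<in>UNIV. a j * f j t\<bar> \<le> (\<Sum>j\<in>UNIV. \<bar>a j\<bar> * ((case j of None \<Rightarrow> d | Some _ \<Rightarrow> c) * exp (- b * t)))"
        using f_le[OF t] by (intro order_trans[OF sum_abs] sum_mono) (auto simp: abs_mult intro: mult_left_mono)
      then show "\<bar>\<Sum>j\<in>UNIV. a j * f j t\<bar> \<le>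
          (\<Sum>j\<in>UNIV. \<bar>a j\<bar> * (case j of None \<Rightarrow> d | Some _ \<Rightarrow> c)) * exp (- b * t)"
        by (simp add: sum_distrib_right mult.assoc)
    qed
    moreover have "laplace (\<lambda>t. \<Sum>j\<in>UNIV. a j * f j t) s = (\<Sum>j\<in>UNIV. complex_of_real (a j) * laplace (f j) s)"
      by (rule laplace_linear_combination[OF finite b _ _ s, where c = "case_option d (\<lambda>_. c)"])
        (use f f_le in auto)
    moreover have "\<dots> = (complex_mat M *v W) $ i + Z $ i"
      by (simp add: UNIV_option_conv sum.reindex f_def a_def matrix_vector_mult_def complex_mat_def W_def Z_def add.commute)
    ultimately show ?thesis by (simp add: W_def)
  qed
  then have "(mat s - complex_mat M) *v W = complex_vec (w 0) + Z"
    by (simp add: vec_eq_iff matrix_vector_mult_diff_rdistrib complex_vec_def)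
      (simp add: matrix_vector_mult_def mat_def if_distrib if_distribR algebra_simps cong: if_cong)
  then have "matrix_inv (mat s - complex_mat M) *v (complex_vec (w 0) + Z) = W"
    by (metis hurwitz_resolvent_invertible[OF M s] matrix_vector_mul_assoc matrix_vector_mul_lid)
  then show ?thesis by (simp add: W_def Z_def)
qed

text \<open>Uniqueness of the transform: the substitution \<open>u = exp (- t)\<close> turns the values at
  \<open>\<sigma> + n\<close> into moments, which determine a function by Weierstrass approximation.\<close>

lemma exp_moments_zero_imp_zero:
  fixes k :: "real \<Rightarrow> real"
  assumes cont: "continuous_on {0..} k" and int: "k absolutely_integrable_on {0..}"
    and mom: "\<And>n. integral {0..} (\<lambda>t. k t * exp (- t) ^ n) = 0" and t0: "t0 \<ge> 0"
  shows "k t0 = 0"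
proof -
  have int_mult: "(\<lambda>t. k t * p (exp (- t))) absolutely_integrable_on {0..}"
    if p: "continuous_on {0..1} p" for p :: "real \<Rightarrow> real"
  proof -
    have sub: "(\<lambda>t::real. exp (- t)) ` {0..} \<subseteq> {0..1}" by auto
    have "(\<lambda>t. p (exp (- t)) * k t) absolutely_integrable_on {0..}"
    proof (rule absolutely_integrable_bounded_measurable_product_real[OF _ _ _ int])
      show "(\<lambda>t. p (exp (- t))) \<in> borel_measurable (lebesgue_on {0..})"
        by (rule continuous_imp_measurable_on_sets_lebesgue)
          (auto intro!: continuous_on_compose2[OF p] continuous_intros)
      have "bounded (p ` {0..1})"
        by (intro compact_imp_bounded compact_continuous_image p) auto
      then show "bounded ((\<lambda>t. p (exp (- t))) ` {0..})"
        by (rule bounded_subset) (use sub in auto)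
    qed auto
    then show ?thesis by (simp add: mult.commute)
  qed
  define N where "N = integral {0..} (\<lambda>t. \<bar>k t\<bar>)"
  have absk: "(\<lambda>t. \<bar>k t\<bar>) integrable_on {0..}"
    using int by (simp add: absolutely_integrable_on_def)
  have N: "N \<ge> 0" unfolding N_def by (rule integral_nonneg[OF absk]) simp
  have zero: "integral {0..} (\<lambda>t. k t * \<phi> (exp (- t))) = 0" if \<phi>: "continuous_on {0..1} \<phi>" for \<phi> :: "real \<Rightarrow> real"
  proof (rule ccontr)
    let ?I = "integral {0..} (\<lambda>t. k t * \<phi> (exp (- t)))"
    assume "?I \<noteq> 0"
    \<comment> \<open>This tolerance times \<open>N\<close>, the integral of the absolute value of
      \<open>k\<close>, stays strictly below \<open>\<bar>?I\<bar>\<close>; the added 1 keeps the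
      denominator positive when \<open>N = 0\<close>.\<close>
    then have e: "\<bar>?I\<bar> / (2 * (N + 1)) > 0" using N by simp
    obtain p where p: "real_polynomial_function p"
      "\<And>x. x \<in> {0..1} \<Longrightarrow> \<bar>\<phi> x - p x\<bar> < \<bar>?I\<bar> / (2 * (N + 1))"
      using Stone_Weierstrass_real_polynomial_function[OF compact_Icc \<phi> e] by blast
    obtain a n where a: "p = (\<lambda>x. \<Sum>i\<le>n. a i * x ^ i)"
      using p(1) real_polynomial_function_iff_sum by blast
    have pc: "continuous_on {0..1} p" unfolding a by (intro continuous_intros)
    have "integral {0..} (\<lambda>t. k t * p (exp (- t))) = integral {0..} (\<lambda>t. \<Sum>i\<le>n. a i * (k t * exp (- t) ^ i))"
      by (simp add: a sum_distrib_left mult_ac)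
    also have "\<dots> = (\<Sum>i\<le>n. integral {0..} (\<lambda>t. a i * (k t * exp (- t) ^ i)))"
      by (intro integral_sum integrable_on_mult_right set_lebesgue_integral_eq_integral(1)
          int_mult[of "\<lambda>x. x ^ _"] continuous_intros) auto
    also have "\<dots> = 0" using mom by simp
    finally have p0: "integral {0..} (\<lambda>t. k t * p (exp (- t))) = 0" .
    have d_int: "(\<lambda>t. k t * (\<phi> (exp (- t)) - p (exp (- t)))) integrable_on {0..}"
      using int_mult[of "\<lambda>x. \<phi> x - p x", THEN set_lebesgue_integral_eq_integral(1)] \<phi> pc
      by (auto intro!: continuous_intros)
    have "?I = integral {0..} (\<lambda>t. k t * \<phi> (exp (- t))) - integral {0..} (\<lambda>t. k t * p (exp (- t)))"
      by (simp add: p0)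
    also have "\<dots> = integral {0..} (\<lambda>t. k t * (\<phi> (exp (- t)) - p (exp (- t))))"
      unfolding right_diff_distrib
      by (intro integral_diff[symmetric] int_mult[THEN set_lebesgue_integral_eq_integral(1)] \<phi> pc)
    finally have I: "?I = integral {0..} (\<lambda>t. k t * (\<phi> (exp (- t)) - p (exp (- t))))" .
    have "\<bar>integral {0..} (\<lambda>t. k t * (\<phi> (exp (- t)) - p (exp (- t))))\<bar>
        \<le> integral {0..} (\<lambda>t. \<bar>?I\<bar> / (2 * (N + 1)) * \<bar>k t\<bar>)"
      unfolding real_norm_def[symmetric, of "integral {0..} (\<lambda>t. k t * (\<phi> (exp (- t)) - p (exp (- t))))"]
    proof (rule integral_norm_bound_integral[OF d_int integrable_on_mult_right[OF absk]])
      fix t :: real assume "t \<in> {0..}"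
      then have "\<bar>\<phi> (exp (- t)) - p (exp (- t))\<bar> \<le> \<bar>?I\<bar> / (2 * (N + 1))"
        by (intro less_imp_le p(2)) auto
      then have "\<bar>k t\<bar> * \<bar>\<phi> (exp (- t)) - p (exp (- t))\<bar> \<le> \<bar>k t\<bar> * (\<bar>?I\<bar> / (2 * (N + 1)))"
        by (rule mult_left_mono) simp
      then show "norm (k t * (\<phi> (exp (- t)) - p (exp (- t)))) \<le> \<bar>?I\<bar> / (2 * (N + 1)) * \<bar>k t\<bar>"
        by (simp only: real_norm_def abs_mult mult.commute[of "\<bar>k t\<bar>"])
    qed
    then have "\<bar>?I\<bar> \<le> integral {0..} (\<lambda>t. \<bar>?I\<bar> / (2 * (N + 1)) * \<bar>k t\<bar>)"
      by (simp only: I[symmetric])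
    also have "\<dots> = \<bar>?I\<bar> / (2 * (N + 1)) * N" by (simp add: N_def)
    also have "\<dots> < \<bar>?I\<bar>" using N mult_strict_left_mono[of N "2 * (N + 1)" "\<bar>?I\<bar>"] \<open>?I \<noteq> 0\<close>
      by (simp add: pos_divide_less_eq)
    finally show False by simp
  qed
  show ?thesis
  proof (rule ccontr)
    assume nz: "k t0 \<noteq> 0"
    \<comment> \<open>The test function is \<open>k\<close> itself, pulled back along
      \<open>t = - ln u\<close> and multiplied by a cutoff. The cutoff vanishes below
      \<open>\<eta>\<close>, and \<open>max u \<eta>\<close> keeps the logarithm finite, so
      \<open>\<phi>\<close> is continuous up to \<open>u = 0\<close>. Its product with
      \<open>k\<close> is a nonnegative multiple of the square of \<open>k\<close>; the shift by 1
      in \<open>\<eta>\<close> makes the weight positive at \<open>t0\<close>.\<close>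
    define \<eta> where "\<eta> = exp (- (t0 + 1))"
    have \<eta>: "0 < \<eta>" "\<eta> < 1" using t0 by (auto simp: \<eta>_def)
    define \<phi> where "\<phi> u = k (- ln (max u \<eta>)) * max 0 (u - \<eta>)" for u
    define h where "h t = k t * \<phi> (exp (- t))" for t
    have \<phi>: "continuous_on {0..1} \<phi>"
      unfolding \<phi>_def using \<eta>
      by (intro continuous_on_mult continuous_on_compose2[OF cont] continuous_intros) auto
    have h_eq: "h t = (k t)\<^sup>2 * max 0 (exp (- t) - \<eta>)" for t
      using \<eta> by (cases "exp (- t) \<le> \<eta>") (auto simp: h_def \<phi>_def power2_eq_square max_def)
    have h: "h integrable_on {0..}" "integral {0..} h = 0"
      unfolding h_def using zero[OF \<phi>] int_mult[OF \<phi>, THEN set_lebesgue_integral_eq_integral(1)] by auto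
    have hc: "continuous_on {0..t0 + 1} h"
      unfolding h_eq by (intro continuous_intros continuous_on_subset[OF cont]) auto
    have "integral {0..t0 + 1} h \<le> integral {0..} h"
      by (rule integral_subset_le) (use h(1) hc in \<open>auto simp: h_eq intro: integrable_continuous_real\<close>)
    moreover have "integral {0..t0 + 1} h \<ge> 0"
      by (rule integral_nonneg) (use hc in \<open>auto simp: h_eq intro: integrable_continuous_real\<close>)
    ultimately have "integral (cbox 0 (t0 + 1)) h = 0" using h(2) by simp
    then have "h t0 = 0"
      using integral_cbox_eq_0_iff[of 0 "t0 + 1" h] hc t0 by (simp add: h_eq)
    moreover have "exp (- t0) > \<eta>" by (simp add: \<eta>_def)
    ultimately show False using nz by (simp add: h_eq)
  qed
qed

lemma laplace_unique:
  assumes f: "continuous_on {0..} f" "laplace_transform_of f F"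
    and g: "continuous_on {0..} g" "laplace_transform_of g F" and t: "t \<ge> 0"
  shows "f t = g t"
proof -
  let ?e = "\<lambda>s t. exp (- s * complex_of_real t)"
  obtain c1 where c1: "\<And>s. Re s > c1 \<Longrightarrow> (\<lambda>t. ?e s t * complex_of_real (f t)) absolutely_integrable_on {0..}
      \<and> integral {0..} (\<lambda>t. ?e s t * complex_of_real (f t)) = F s"
    using f(2) unfolding laplace_transform_of_def by blast
  obtain c2 where c2: "\<And>s. Re s > c2 \<Longrightarrow> (\<lambda>t. ?e s t * complex_of_real (g t)) absolutely_integrable_on {0..}
      \<and> integral {0..} (\<lambda>t. ?e s t * complex_of_real (g t)) = F s"
    using g(2) unfolding laplace_transform_of_def by blast
  \<comment> \<open>The added 1 puts every real \<open>\<sigma> + n\<close> strictly inside both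
    half-planes of convergence.\<close>
  define \<sigma> where "\<sigma> = max c1 c2 + 1"
  define k where "k t = exp (- \<sigma> * t) * (f t - g t)" for t
  have diff: "(\<lambda>t. exp (- \<tau> * t) * (f t - g t)) absolutely_integrable_on {0..}
      \<and> integral {0..} (\<lambda>t. exp (- \<tau> * t) * (f t - g t)) = 0" if "\<tau> \<ge> \<sigma>" for \<tau> :: real
  proof -
    define G where "G t = ?e \<tau> t * complex_of_real (f t) - ?e \<tau> t * complex_of_real (g t)" for t
    have \<tau>: "Re (complex_of_real \<tau>) > c1" "Re (complex_of_real \<tau>) > c2"
      using that by (auto simp: \<sigma>_def)
    have G: "G absolutely_integrable_on {0..}"
      unfolding G_def using c1[OF \<tau>(1)] c2[OF \<tau>(2)] by (intro set_integral_diff(1)) auto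
    have G0: "integral {0..} G = 0"
      unfolding G_def using c1[OF \<tau>(1)] c2[OF \<tau>(2)]
      by (subst integral_diff) (auto intro: set_lebesgue_integral_eq_integral(1))
    have Re_G: "Re \<circ> G = (\<lambda>t. exp (- \<tau> * t) * (f t - g t))"
      by (auto simp: G_def fun_eq_iff Re_exp algebra_simps)
    show ?thesis
      using absolutely_integrable_linear[OF G bounded_linear_Re]
        integral_linear[OF set_lebesgue_integral_eq_integral(1)[OF G] bounded_linear_Re] G0
      unfolding Re_G by simp
  qed
  have "k t = 0"
  proof (rule exp_moments_zero_imp_zero[OF _ _ _ t])
    show "continuous_on {0..} k"
      unfolding k_def by (intro continuous_intros f(1) g(1))
    show "k absolutely_integrable_on {0..}"
      using diff[of \<sigma>] by (simp add: k_def[abs_def])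
    fix n :: nat
    have "(\<lambda>t. k t * exp (- t) ^ n) = (\<lambda>t. exp (- (\<sigma> + n) * t) * (f t - g t))"
      by (simp add: fun_eq_iff k_def exp_of_nat_mult[symmetric] algebra_simps exp_add[symmetric])
    then show "integral {0..} (\<lambda>t. k t * exp (- t) ^ n) = 0"
      using diff[of "\<sigma> + n"] by simp
  qed
  then show ?thesis by (simp add: k_def)
qed

text \<open>The described signal is \<open>f\<close> set to zero at negative times; any competitor
  agrees with it on \<open>{0..}\<close> by \<open>laplace_unique\<close>. The values of
  \<open>f\<close> at negative times are left free, which suits solutions of equations on the whole
  line.\<close>

lemma time_signal_eq:
  assumes f: "continuous_on {0..} f" "laplace_transform_of f F" and t: "t \<ge> 0"
  shows "time_signal F t = f t"
proof -
  define g where "g t = (if t < 0 then 0 else f t)" for t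
  have cong: "laplace_transform_of h F \<longleftrightarrow> laplace_transform_of f F" if "\<And>t. t \<ge> 0 \<Longrightarrow> h t = f t" for h
  proof -
    have "(\<lambda>t. exp (- s * complex_of_real t) * complex_of_real (h t)) absolutely_integrable_on {0..} \<longleftrightarrow>
        (\<lambda>t. exp (- s * complex_of_real t) * complex_of_real (f t)) absolutely_integrable_on {0..}" for s
      by (rule set_integrable_cong) (auto simp: that)
    moreover have "integral {0..} (\<lambda>t. exp (- s * complex_of_real t) * complex_of_real (h t)) =
        integral {0..} (\<lambda>t. exp (- s * complex_of_real t) * complex_of_real (f t))" for s
      by (rule Henstock_Kurzweil_Integration.integral_cong) (auto simp: that)
    ultimately show ?thesis by (simp add: laplace_transform_of_def)
  qed
  have "time_signal F = g"
    unfolding time_signal_def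
  proof (rule the_equality)
    have "continuous_on {0..} g \<longleftrightarrow> continuous_on {0..} f"
      by (rule continuous_on_cong) (auto simp: g_def)
    then show "continuous_on {0..} g \<and> (\<forall>t<0. g t = 0) \<and> laplace_transform_of g F"
      using f cong[of g] by (auto simp: g_def)
    fix h assume h: "continuous_on {0..} h \<and> (\<forall>t<0. h t = 0) \<and> laplace_transform_of h F"
    show "h = g"
    proof
      fix t show "h t = g t"
        using h laplace_unique[of h F f t] f by (cases "t < 0") (auto simp: g_def)
    qed
  qed
  then show ?thesis using t by (simp add: g_def)
qed

section \<open>State sensitivities and quadratic costs\<close>

lemma state_variation_add:
  assumes "state_variation A B K H y" "state_variation A B K H' y'"
  shows "state_variation A B K (H + H') (\<lambda>t. y t + y' t)"
  unfolding state_variation_def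
proof (intro conjI allI)
  show "y 0 + y' 0 = 0" using assms by (simp add: state_variation_def)
  fix t
  have "((\<lambda>t. y t + y' t) has_vector_derivative
      ((A + B ** K) *v y t + (B ** H) *v state A B K t) + ((A + B ** K) *v y' t + (B ** H') *v state A B K t)) (at t)"
    using assms by (intro has_vector_derivative_add) (auto simp: state_variation_def)
  then show "((\<lambda>t. y t + y' t) has_vector_derivative
      (A + B ** K) *v (y t + y' t) + (B ** (H + H')) *v state A B K t) (at t)"
    by (simp add: matrix_vector_right_distrib matrix_add_ldistrib matrix_vector_mult_add_rdistrib add_ac)
qed

lemma state_variation_scaleR:
  assumes "state_variation A B K H y"
  shows "state_variation A B K (a *\<^sub>R H) (\<lambda>t. a *\<^sub>R y t)"
  unfolding state_variation_def
proof (intro conjI allI)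
  show "a *\<^sub>R y 0 = 0" using assms by (simp add: state_variation_def)
  fix t
  have "((\<lambda>t. a *\<^sub>R y t) has_vector_derivative
      a *\<^sub>R ((A + B ** K) *v y t + (B ** H) *v state A B K t)) (at t)"
    using assms by (intro bounded_linear.has_vector_derivative[OF bounded_linear_scaleR_right])
      (auto simp: state_variation_def)
  then show "((\<lambda>t. a *\<^sub>R y t) has_vector_derivative
      (A + B ** K) *v (a *\<^sub>R y t) + (B ** (a *\<^sub>R H)) *v state A B K t) (at t)"
    by (simp add: matrix_vector_mult_scaleR matrix_scalar_ac scalar_matrix_assoc[symmetric]
        scaleR_matrix_vector_assoc[symmetric] scaleR_add_right)
qed

lemma state_variation_sum:
  assumes "finite J" "\<And>j. j \<in> J \<Longrightarrow> state_variation A B K (H j) (y j)"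
  shows "state_variation A B K (\<Sum>j\<in>J. H j) (\<lambda>t. \<Sum>j\<in>J. y j t)"
  using assms
proof (induction rule: finite_induct)
  case empty
  then show ?case by (simp add: state_variation_def)
next
  case (insert j J)
  then show ?case by (simp add: state_variation_add)
qed

lemma state_variation_continuous:
  assumes "state_variation A B K H y"
  shows "continuous_on S y"
  using assms unfolding state_variation_def
  by (meson continuous_at_imp_continuous_on has_vector_derivative_continuous)

lemma state_continuous: "continuous_on S (state A B K)"
  using state_ode[of A B K _ UNIV]
  by (meson continuous_at_imp_continuous_on has_vector_derivative_continuous)

section \<open>Matrix units and the entries of the sensitivity\<close>

definition unit_mat :: "'m \<Rightarrow> 'n \<Rightarrow> real^'n^'m" where
  "unit_mat f g = (\<chi> i j. if i = f \<and> j = g then 1 else 0)"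

lemma sum_unit_mat: "H = (\<Sum>f\<in>UNIV. \<Sum>g\<in>UNIV. H $ f $ g *\<^sub>R unit_mat f g)"
proof -
  have "(\<Sum>f\<in>UNIV. \<Sum>g\<in>UNIV. H $ f $ g * (if i = f \<and> j = g then 1 else 0)) = H $ i $ j" for i j
  proof -
    have "(\<Sum>f\<in>UNIV. \<Sum>g\<in>UNIV. H $ f $ g * (if i = f \<and> j = g then 1 else 0))
        = (\<Sum>f\<in>UNIV. if i = f then H $ i $ j else 0)"
      by (intro sum.cong) (auto simp: if_distrib cong: if_cong)
    then show ?thesis by simp
  qed
  then show ?thesis by (simp add: vec_eq_iff unit_mat_def)
qed

lemma unit_mat_mult: "((B ** unit_mat f g) *v x) $ k = B $ k $ f * x $ g"
proof -
  have "unit_mat f g *v x = axis f (x $ g)"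
    by (auto simp: vec_eq_iff matrix_vector_mult_def unit_mat_def axis_def if_distrib if_distribR cong: if_cong)
  then have "(B ** unit_mat f g) *v x = B *v axis f (x $ g)"
    by (metis matrix_vector_mul_assoc)
  then show ?thesis
    by (simp add: matrix_vector_mult_def axis_def if_distrib cong: if_cong)
qed

text \<open>The transfer matrix is an outer product: a column, the transform of the state, times row
  \<open>i\<close> of \<open>A_plus\<close> times \<open>B\<close>.\<close>

lemma sens_transfer_component:
  fixes A :: "real^'n^'n" and B :: "real^'m^'n" and K :: "real^'n^'m"
  shows
  "sens_transfer A B K i s $ g $ f =
     (A_plus A B K s *v complex_vec (B *v vec 1)) $ g * (A_plus A B K s ** complex_mat B) $ i $ f"
proof -
  let ?P = "A_plus A B K s" and ?c = "columnvector (vec 1) :: complex^1^'m"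
    and ?r = "rowvector (axis i 1) :: complex^'n^1"
  have "sens_transfer A B K i s = (?P ** complex_mat B ** ?c) ** (?r ** (?P ** complex_mat B))"
    by (simp add: sens_transfer_def matrix_mul_assoc)
  moreover have outer: "(X ** Y) $ g $ f = X $ g $ 1 * Y $ 1 $ f" for X :: "complex^1^'n" and Y :: "complex^'m^1"
    by (simp add: matrix_matrix_mult_def UNIV_1)
  ultimately have "sens_transfer A B K i s $ g $ f =
      (?P ** complex_mat B ** ?c) $ g $ 1 * (?r ** (?P ** complex_mat B)) $ 1 $ f"
    by (simp only: outer)
  moreover have "(X ** ?c) $ g $ 1 = (X *v vec 1) $ g" for X :: "complex^'m^'n"
    by (simp add: matrix_matrix_mult_def matrix_vector_mult_def columnvector_def)
  moreover have "(?r ** X) $ 1 $ f = X $ i $ f" for X :: "complex^'m^'n"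
    by (simp add: matrix_matrix_mult_def rowvector_def axis_def if_distrib if_distribR cong: if_cong)
  moreover have "complex_vec (vec 1 :: real^'m) = vec 1"
    by (simp add: complex_vec_def vec_eq_iff)
  ultimately show ?thesis
    by (simp add: complex_vec_mult matrix_vector_mul_assoc)
qed

lemma A_plus_eq: "A_plus A B K s = matrix_inv (mat s - complex_mat (A + B ** K))"
proof -
  have "complex_mat (A + B ** K) = complex_mat A + complex_mat B ** complex_mat K"
    by (simp add: complex_mat_def vec_eq_iff matrix_matrix_mult_def)
  then show ?thesis by (simp add: A_plus_def diff_diff_eq)
qed

text \<open>A unit perturbation drives the linearised system through column \<open>f\<close> of
  \<open>B\<close> with the scalar signal \<open>x_g\<close>. Applying the resolvent to its
  transform gives entry \<open>(g, f)\<close> of the transfer matrix, which the transposition in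
  \<open>state_sens\<close> moves to \<open>(f, g)\<close>.\<close>

lemma state_sens_component:
  fixes A :: "real^'n^'n" and B :: "real^'m^'n"
  assumes hw: "hurwitz (A + B ** K)" and y: "state_variation A B K (unit_mat f g) y" and t: "t \<ge> 0"
  shows "state_sens A B K i t $ f $ g = y t $ i"
proof -
  let ?M = "A + B ** K" and ?E = "unit_mat f g :: real^'n^'m"
  obtain b c \<delta> where b: "b > 0" and \<delta>: "\<delta> > 0"
    and x_le: "\<And>H t. norm H < \<delta> \<Longrightarrow> t \<ge> 0 \<Longrightarrow> norm (state A B (K + H) t) \<le> c * exp (- b * t)"
    and y_le: "\<And>H y t. state_variation A B K H y \<Longrightarrow> t \<ge> 0 \<Longrightarrow> norm (y t) \<le> c * norm H * exp (- b * t)"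
    by (rule state_expansion[OF hw]) (rule that; assumption)
  have x0_le: "norm (state A B K t) \<le> c * exp (- b * t)" if "t \<ge> 0" for t
    using x_le[of 0 t] \<delta> that by simp
  have z_le: "norm ((B ** ?E) *v state A B K t) \<le> norm (B ** ?E) * c * exp (- b * t)" if "t \<ge> 0" for t
    using order_trans[OF norm_matrix_vector_mult_le mult_left_mono[OF x0_le[OF that]]]
    by (simp add: mult.assoc)
  have y': "(y has_vector_derivative ?M *v y t + (B ** ?E) *v state A B K t) (at t)" for t
    using y by (simp add: state_variation_def)
  have yi_le: "\<bar>y t $ i\<bar> \<le> c * norm ?E * exp (- b * t)" if "t \<ge> 0" for t
    using component_le_norm_cart[of "y t" i] y_le[OF y that] by linarith
  have yi_cont: "continuous_on {0..} (\<lambda>t. y t $ i)"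
    by (intro continuous_intros state_variation_continuous[OF y])
  have tr: "laplace (\<lambda>t. y t $ i) s = sens_transfer A B K i s $ g $ f" if s: "Re s > 0" for s
  proof -
    define P where "P = A_plus A B K s"
    define X where "X = (\<chi> i. laplace (\<lambda>t. state A B K t $ i) s)"
    have X: "X = P *v complex_vec (B *v vec 1)"
    proof -
      have "X = P *v (complex_vec (state A B K 0) + (\<chi> i. laplace (\<lambda>t. (0 :: real^'n) $ i) s))"
        unfolding X_def P_def A_plus_eq
        by (rule laplace_ode[OF hw _ _ b x0_le, where d = 0 and z = "\<lambda>_. 0"])
          (use state_ode[of A B K _ UNIV] s in auto)
      moreover have "(\<chi> i. laplace (\<lambda>t. (0 :: real^'n) $ i) s) = 0"
        by (simp add: vec_eq_iff laplace_def)
      ultimately show ?thesis by (simp add: state_initial)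
    qed
    have "(\<chi> i. laplace (\<lambda>t. y t $ i) s) =
        P *v (complex_vec (y 0) + (\<chi> i. laplace (\<lambda>t. ((B ** ?E) *v state A B K t) $ i) s))"
      unfolding P_def A_plus_eq
      by (rule laplace_ode[OF hw y' _ b y_le[OF y] z_le])
        (use s in \<open>auto intro!: bounded_linear.continuous_on[OF matrix_vector_mul_bounded_linear] state_continuous\<close>)
    moreover have "laplace (\<lambda>t. ((B ** ?E) *v state A B K t) $ k) s = complex_of_real (B $ k $ f) * X $ g" for k
      by (simp add: unit_mat_mult X_def laplace_def mult.left_commute[of "exp _"])
    moreover have "complex_vec (y 0) = 0"
      using y by (simp add: state_variation_def complex_vec_def vec_eq_iff)
    ultimately have "laplace (\<lambda>t. y t $ i) s = (P *v (\<chi> k. complex_of_real (B $ k $ f) * X $ g)) $ i"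
      by (simp add: vec_eq_iff)
    also have "\<dots> = X $ g * (P ** complex_mat B) $ i $ f"
      by (simp add: matrix_vector_mult_def matrix_matrix_mult_def complex_mat_def sum_distrib_left mult_ac)
    finally show ?thesis by (simp add: sens_transfer_component X P_def)
  qed
  have "laplace_transform_of (\<lambda>t. y t $ i) (\<lambda>s. sens_transfer A B K i s $ g $ f)"
    unfolding laplace_transform_of_def
  proof (intro exI[of _ 0] allI impI conjI)
    fix s :: complex assume s: "Re s > 0"
    show "(\<lambda>t. exp (- s * complex_of_real t) * complex_of_real (y t $ i)) absolutely_integrable_on {0..}"
      by (rule laplace_integrand_absolutely_integrable[OF yi_cont b yi_le]) (use s in auto)
    show "integral {0..} (\<lambda>t. exp (- s * complex_of_real t) * complex_of_real (y t $ i)) = sens_transfer A B K i s $ g $ f"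
      using tr[OF s] by (simp add: laplace_def)
  qed
  then have "time_signal (\<lambda>s. sens_transfer A B K i s $ g $ f) t = y t $ i"
    by (rule time_signal_eq[OF yi_cont _ t])
  then show ?thesis
    by (simp add: state_sens_def transpose_def time_signal_mat_def)
qed

text \<open>The inner product of matrices is entrywise, so this is the superposition of the
  variations for matrix units, weighted by the entries of \<open>H\<close>.\<close>

lemma state_sens_variation:
  fixes A :: "real^'n^'n" and B :: "real^'m^'n" and H :: "real^'n^'m"
  assumes hw: "hurwitz (A + B ** K)"
  obtains y where "state_variation A B K H y" "\<And>i t. t \<ge> 0 \<Longrightarrow> H \<bullet> state_sens A B K i t = y t $ i"
proof -
  define Y where "Y f g = (SOME y. state_variation A B K (unit_mat f g) y)" for f g
  have Y: "state_variation A B K (unit_mat f g) (Y f g)" for f g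
    unfolding Y_def by (rule someI_ex[OF state_variation_exists])
  show thesis
  proof
    let ?y = "\<lambda>t. \<Sum>f\<in>UNIV. \<Sum>g\<in>UNIV. H $ f $ g *\<^sub>R Y f g t"
    show "state_variation A B K H ?y"
      by (subst sum_unit_mat[of H]) (intro state_variation_sum state_variation_scaleR Y finite)
    show "H \<bullet> state_sens A B K i t = ?y t $ i" if "t \<ge> 0" for i t
      by (simp add: inner_vec_def state_sens_component[OF hw Y that])
  qed
qed

lemma state_sens_continuous:
  fixes A :: "real^'n^'n" and B :: "real^'m^'n"
  assumes hw: "hurwitz (A + B ** K)"
  shows "continuous_on {0..} (state_sens A B K i)"
proof -
  define Y where "Y f g = (SOME y. state_variation A B K (unit_mat f g) y)" for f g
  have Y: "state_variation A B K (unit_mat f g) (Y f g)" for f g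
    unfolding Y_def by (rule someI_ex[OF state_variation_exists])
  have "continuous_on {0..} (\<lambda>t. \<chi> f g. Y f g t $ i)"
    by (intro continuous_intros state_variation_continuous[OF Y])
  also have "?this \<longleftrightarrow> ?thesis"
    by (rule continuous_on_cong) (simp_all add: vec_eq_iff state_sens_component[OF hw Y])
  finally show ?thesis .
qed

section \<open>Gradients from quadratic remainders, and energies of decaying signals\<close>

lemma gderiv_quadratic_remainder:
  fixes F :: "'a::real_inner \<Rightarrow> real"
  assumes "\<delta> > 0" and rem: "\<And>h. norm h < \<delta> \<Longrightarrow> \<bar>F (x + h) - F x - h \<bullet> D\<bar> \<le> c * (norm h)\<^sup>2"
  shows "GDERIV F x :> D"
  unfolding gderiv_def has_derivative_at
proof (intro conjI bounded_linear_inner_left)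
  show "(\<lambda>h. norm (F (x + h) - F x - h \<bullet> D) / norm h) \<midarrow>0\<rightarrow> 0"
  proof (rule Lim_null_comparison)
    show "\<forall>\<^sub>F h in at 0. norm (norm (F (x + h) - F x - h \<bullet> D) / norm h) \<le> c * norm h"
      unfolding eventually_at
    proof (intro exI[of _ \<delta>] conjI ballI impI)
      fix h :: 'a assume h: "h \<noteq> 0 \<and> dist h 0 < \<delta>"
      then show "norm (norm (F (x + h) - F x - h \<bullet> D) / norm h) \<le> c * norm h"
        using rem[of h] by (simp add: pos_divide_le_eq power2_eq_square mult.assoc)
    qed (rule assms(1))
    show "((\<lambda>h. c * norm h) \<longlongrightarrow> 0) (at 0)"
      by (auto intro!: tendsto_eq_intros)
  qed
qed

text \<open>The common interface of the signals \<open>x_i\<close> and \<open>u_j\<close>, so that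
  gradients and energies are treated once. The bound on \<open>h \<bullet> S t\<close> is
  homogeneous in \<open>h\<close> and hence imposed for all \<open>h\<close>; at
  \<open>h = S t\<close> it controls \<open>norm (S t)\<close>.\<close>

definition exp_expansion ::
  "('a::euclidean_space \<Rightarrow> real \<Rightarrow> real) \<Rightarrow> 'a \<Rightarrow> (real \<Rightarrow> 'a) \<Rightarrow> real \<Rightarrow> real \<Rightarrow> real \<Rightarrow> bool" where
  "exp_expansion f x S b c \<delta> \<longleftrightarrow> b > 0 \<and> c \<ge> 0 \<and> \<delta> > 0 \<and> continuous_on {0..} S \<and>
     (\<forall>h. norm h < \<delta> \<longrightarrow> continuous_on {0..} (f (x + h))) \<and>
     (\<forall>h t. norm h < \<delta> \<longrightarrow> t \<ge> 0 \<longrightarrow> \<bar>f (x + h) t\<bar> \<le> c * exp (- b * t)) \<and>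
     (\<forall>h t. t \<ge> 0 \<longrightarrow> \<bar>h \<bullet> S t\<bar> \<le> c * norm h * exp (- b * t)) \<and>
     (\<forall>h t. norm h < \<delta> \<longrightarrow> t \<ge> 0 \<longrightarrow>
        \<bar>f (x + h) t - f x t - h \<bullet> S t\<bar> \<le> c * (norm h)\<^sup>2 * exp (- b * t))"

lemma exp_expansion_gderiv:
  assumes "exp_expansion f x S b c \<delta>" "t \<ge> 0"
  shows "GDERIV (\<lambda>x. f x t) x :> S t"
proof (rule gderiv_quadratic_remainder)
  show "\<delta> > 0" using assms by (simp add: exp_expansion_def)
  show "\<bar>f (x + h) t - f x t - h \<bullet> S t\<bar> \<le> (c * exp (- b * t)) * (norm h)\<^sup>2" if "norm h < \<delta>" for h
  proof -
    have "\<bar>f (x + h) t - f x t - h \<bullet> S t\<bar> \<le> c * (norm h)\<^sup>2 * exp (- b * t)"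
      using assms that unfolding exp_expansion_def by blast
    then show ?thesis by (simp only: mult_ac)
  qed
qed

lemma exp_expansion_energy:
  fixes x :: "'a::euclidean_space"
  assumes ex: "exp_expansion f x S b c \<delta>"
  shows "norm h < \<delta> \<Longrightarrow> (\<lambda>t. (f (x + h) t)\<^sup>2 / 2) absolutely_integrable_on {0..}"
    and "(\<lambda>t. f x t *\<^sub>R S t) absolutely_integrable_on {0..}"
    and "GDERIV (\<lambda>x. integral {0..} (\<lambda>t. (f x t)\<^sup>2 / 2)) x :> integral {0..} (\<lambda>t. f x t *\<^sub>R S t)"
proof -
  have b: "b > 0" and c: "c \<ge> 0" and \<delta>: "\<delta> > 0" and S: "continuous_on {0..} S"
    and f: "\<And>h. norm h < \<delta> \<Longrightarrow> continuous_on {0..} (f (x + h))"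
    and f_le: "\<And>h t. norm h < \<delta> \<Longrightarrow> t \<ge> 0 \<Longrightarrow> \<bar>f (x + h) t\<bar> \<le> c * exp (- b * t)"
    and S_le: "\<And>h t. t \<ge> 0 \<Longrightarrow> \<bar>h \<bullet> S t\<bar> \<le> c * norm h * exp (- b * t)"
    and r_le: "\<And>h t. norm h < \<delta> \<Longrightarrow> t \<ge> 0 \<Longrightarrow>
        \<bar>f (x + h) t - f x t - h \<bullet> S t\<bar> \<le> c * (norm h)\<^sup>2 * exp (- b * t)"
    using ex unfolding exp_expansion_def by blast+
  have f0: "continuous_on {0..} (f x)" and f0_le: "\<And>t. t \<ge> 0 \<Longrightarrow> \<bar>f x t\<bar> \<le> c * exp (- b * t)"
    using f[of 0] f_le[of 0] \<delta> by auto
  have normS: "norm (S t) \<le> c * exp (- b * t)" if "t \<ge> 0" for t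
  proof (cases "S t = 0")
    case False
    have "norm (S t) * norm (S t) \<le> (c * exp (- b * t)) * norm (S t)"
      using S_le[OF that, of "S t"] by (simp add: power2_norm_eq_inner[symmetric] power2_eq_square mult_ac)
    then show ?thesis using False by simp
  qed (use c in simp)
  have prod: "\<bar>u\<bar> * \<bar>v\<bar> \<le> (m * n) * exp (- (2 * b) * t)"
    if "\<bar>u\<bar> \<le> m * exp (- b * t)" "\<bar>v\<bar> \<le> n * exp (- b * t)" for u v m n t
  proof -
    have "\<bar>u\<bar> * \<bar>v\<bar> \<le> (m * exp (- b * t)) * (n * exp (- b * t))"
      using that by (intro mult_mono) (auto intro: order_trans[OF abs_ge_zero])
    also have "\<dots> = (m * n) * exp (- (2 * b) * t)"
      by (simp add: exp_add[symmetric] mult_ac)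
    finally show ?thesis .
  qed
  show int: "(\<lambda>t. (f (x + h) t)\<^sup>2 / 2) absolutely_integrable_on {0..}" if h: "norm h < \<delta>" for h
  proof (rule exp_decay_absolutely_integrable)
    show "norm ((f (x + h) t)\<^sup>2 / 2) \<le> (c * c) * exp (- (2 * b) * t)" if "t \<ge> 0" for t
    proof -
      have "norm ((f (x + h) t)\<^sup>2 / 2) \<le> \<bar>f (x + h) t\<bar> * \<bar>f (x + h) t\<bar>"
        using zero_le_square[of "f (x + h) t"] by (simp add: power2_eq_square)
      also have "\<dots> \<le> (c * c) * exp (- (2 * b) * t)"
        by (rule prod[OF f_le[OF h that] f_le[OF h that]])
      finally show ?thesis .
    qed
  qed (use b f[OF h] in \<open>auto intro!: continuous_intros\<close>)
  show intS: "(\<lambda>t. f x t *\<^sub>R S t) absolutely_integrable_on {0..}"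
  proof (rule exp_decay_absolutely_integrable)
    show "norm (f x t *\<^sub>R S t) \<le> (c * c) * exp (- (2 * b) * t)" if "t \<ge> 0" for t
      using prod[OF f0_le[OF that], of "norm (S t)" c] normS[OF that] by simp
  qed (use b f0 S in \<open>auto intro!: continuous_intros\<close>)
  \<comment> \<open>The first summand bounds \<open>f x t\<close> times the remainder; the second
    bounds the square of the increment, which is at most \<open>c * (1 + \<delta>) * norm h\<close>
    times the exponential.\<close>
  define C where "C = c * c + (c * (1 + \<delta>)) * (c * (1 + \<delta>))"
  show "GDERIV (\<lambda>x. integral {0..} (\<lambda>t. (f x t)\<^sup>2 / 2)) x :> integral {0..} (\<lambda>t. f x t *\<^sub>R S t)"
  proof (rule gderiv_quadratic_remainder[OF \<delta>])
    fix h :: 'a assume h: "norm h < \<delta>"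
    have i1: "(\<lambda>t. (f (x + h) t)\<^sup>2 / 2) integrable_on {0..}"
      using int[OF h] by (rule set_lebesgue_integral_eq_integral(1))
    have i2: "(\<lambda>t. (f x t)\<^sup>2 / 2) integrable_on {0..}"
      using set_lebesgue_integral_eq_integral(1)[OF int[of 0]] \<delta> by simp
    have i3: "(\<lambda>t. f x t *\<^sub>R S t) integrable_on {0..}"
      using intS by (rule set_lebesgue_integral_eq_integral(1))
    have hi3: "(\<lambda>t. h \<bullet> (f x t *\<^sub>R S t)) integrable_on {0..}"
      and hi3': "integral {0..} (\<lambda>t. h \<bullet> (f x t *\<^sub>R S t)) = h \<bullet> integral {0..} (\<lambda>t. f x t *\<^sub>R S t)"
      using integrable_linear[OF i3 bounded_linear_inner_right[of h]]
        integral_linear[OF i3 bounded_linear_inner_right[of h]] by (simp_all add: o_def)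
    define R where "R t = (f (x + h) t)\<^sup>2 / 2 - (f x t)\<^sup>2 / 2 - h \<bullet> (f x t *\<^sub>R S t)" for t
    have R: "R integrable_on {0..}" unfolding R_def by (intro integrable_diff i1 i2 hi3)
    have R_eq: "integral {0..} (\<lambda>t. (f (x + h) t)\<^sup>2 / 2) - integral {0..} (\<lambda>t. (f x t)\<^sup>2 / 2)
        - h \<bullet> integral {0..} (\<lambda>t. f x t *\<^sub>R S t) = integral {0..} R"
      unfolding R_def
      by (simp only: integral_diff[OF integrable_diff[OF i1 i2] hi3] integral_diff[OF i1 i2] hi3')
    have "norm (integral {0..} R) \<le> integral {0..} (\<lambda>t. (C * (norm h)\<^sup>2) * exp (- (2 * b) * t))"
    proof (rule integral_norm_bound_integral[OF R])
      show "(\<lambda>t. (C * (norm h)\<^sup>2) * exp (- (2 * b) * t)) integrable_on {0..}"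
        using integrable_on_exp_minus_to_infinity[of "2 * b" 0] b by (intro integrable_on_mult_right) auto
      fix t :: real assume "t \<in> {0..}"
      then have t: "t \<ge> 0" by simp
      define \<rho> where "\<rho> = f (x + h) t - f x t - h \<bullet> S t"
      define d where "d = f (x + h) t - f x t"
      \<comment> \<open>The part of the difference of squares that is linear in \<open>h\<close>
        cancels; both surviving terms are of second order.\<close>
      have "R t = f x t * \<rho> + d * d / 2"
        unfolding R_def \<rho>_def d_def by (simp add: power2_eq_square field_simps)
      moreover have "\<bar>f x t\<bar> * \<bar>\<rho>\<bar> \<le> (c * (c * (norm h)\<^sup>2)) * exp (- (2 * b) * t)"
        using r_le[OF h t] by (intro prod f0_le[OF t]) (simp add: \<rho>_def)
      moreover have "\<bar>d\<bar> * \<bar>d\<bar> \<le> ((c * (1 + \<delta>) * norm h) * (c * (1 + \<delta>) * norm h)) * exp (- (2 * b) * t)"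
      proof -
        have "\<bar>d\<bar> \<le> \<bar>h \<bullet> S t\<bar> + \<bar>\<rho>\<bar>" by (simp add: d_def \<rho>_def)
        also have "\<dots> \<le> c * norm h * exp (- b * t) + c * (norm h)\<^sup>2 * exp (- b * t)"
          unfolding \<rho>_def by (intro add_mono S_le r_le h t)
        also have "\<dots> = c * norm h * (1 + norm h) * exp (- b * t)"
          by (simp add: algebra_simps power2_eq_square)
        also have "\<dots> \<le> c * norm h * (1 + \<delta>) * exp (- b * t)"
          using c h by (intro mult_right_mono mult_left_mono) auto
        finally have "\<bar>d\<bar> \<le> (c * (1 + \<delta>) * norm h) * exp (- b * t)" by (simp add: mult_ac)
        then show ?thesis by (intro prod)
      qed
      ultimately have "\<bar>R t\<bar> \<le> (c * (c * (norm h)\<^sup>2)) * exp (- (2 * b) * t)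
          + ((c * (1 + \<delta>) * norm h) * (c * (1 + \<delta>) * norm h)) * exp (- (2 * b) * t)"
        using abs_triangle_ineq[of "f x t * \<rho>" "d * d / 2"] abs_ge_zero[of "d * d"]
        unfolding abs_mult[symmetric] by (simp only: abs_mult abs_divide abs_numeral)
      then show "norm (R t) \<le> (C * (norm h)\<^sup>2) * exp (- (2 * b) * t)"
        by (simp add: C_def algebra_simps power2_eq_square)
    qed
    also have "\<dots> = (C * integral {0..} (\<lambda>t. exp (- (2 * b) * t))) * (norm h)\<^sup>2"
      by (simp add: mult_ac)
    finally show "\<bar>integral {0..} (\<lambda>t. (f (x + h) t)\<^sup>2 / 2) - integral {0..} (\<lambda>t. (f x t)\<^sup>2 / 2)
        - h \<bullet> integral {0..} (\<lambda>t. f x t *\<^sub>R S t)\<bar>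
      \<le> (C * integral {0..} (\<lambda>t. exp (- (2 * b) * t))) * (norm h)\<^sup>2"
      by (simp only: R_eq real_norm_def)
  qed
qed

text \<open>For \<open>u\<close> this is the product rule: from \<open>x(K + H) = x + y + r\<close>
  the increment of \<open>u\<close> is \<open>K y + H x\<close>, linear in \<open>H\<close>, plus
  the quadratically small \<open>K r + H (y + r)\<close>.\<close>

lemma state_feedback_exp_expansion:
  fixes A :: "real^'n^'n" and B :: "real^'m^'n" and K :: "real^'n^'m"
  assumes hw: "hurwitz (A + B ** K)"
  obtains b c \<delta> where
    "\<And>i. exp_expansion (\<lambda>K' t. state A B K' t $ i) K (state_sens A B K i) b c \<delta>"
    "\<And>j. exp_expansion (\<lambda>K' t. feedback A B K' t $ j) K (feedback_sens A B K j) b c \<delta>"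
proof -
  obtain b c \<delta> where b: "b > 0" and c: "c \<ge> 0" and \<delta>: "\<delta> > 0"
    and x_le: "\<And>H t. norm H < \<delta> \<Longrightarrow> t \<ge> 0 \<Longrightarrow> norm (state A B (K + H) t) \<le> c * exp (- b * t)"
    and y_le: "\<And>H y t. state_variation A B K H y \<Longrightarrow> t \<ge> 0 \<Longrightarrow> norm (y t) \<le> c * norm H * exp (- b * t)"
    and r_le: "\<And>H y t. norm H < \<delta> \<Longrightarrow> state_variation A B K H y \<Longrightarrow> t \<ge> 0 \<Longrightarrow>
      norm (state A B (K + H) t - state A B K t - y t) \<le> c * (norm H)\<^sup>2 * exp (- b * t)"
    by (rule state_expansion[OF hw]) (rule that; assumption)
  have x0_le: "norm (state A B K t) \<le> c * exp (- b * t)" if "t \<ge> 0" for t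
    using x_le[of 0 t] \<delta> that by simp
  define \<kappa> where "\<kappa> = norm K + \<delta>"
  have \<kappa>: "\<kappa> \<ge> 0" "norm K \<le> \<kappa>" using \<delta> by (auto simp: \<kappa>_def)
  \<comment> \<open>Dominates the factors arising below: \<open>c\<close> for the state,
    \<open>c * \<kappa>\<close> and \<open>c * (\<kappa> + 1)\<close> for the feedback and its
    first-order part, \<open>c * (\<kappa> + 1 + norm H)\<close> for its remainder. Here
    \<open>\<kappa>\<close> bounds the norms of all gains \<open>K + H\<close>.\<close>
  define c' where "c' = c * (\<kappa> + 2 + \<delta>)"
  have cc': "c \<le> c'" "c * \<kappa> \<le> c'" "c * (\<kappa> + 1) \<le> c'" "c' \<ge> 0"
    unfolding c'_def using c \<kappa> \<delta> mult_left_mono[of 1 "\<kappa> + 2 + \<delta>" c] mult_left_mono[of _ "\<kappa> + 2 + \<delta>" c] by auto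
  have mono: "u * exp (- b * t) \<le> v * exp (- b * t)" if "u \<le> v" for u v t
    using that by (rule mult_right_mono) simp
  have cut: "\<bar>v $ k\<bar> \<le> B" if "norm v \<le> B" for v :: "real^'k" and k B
    using component_le_norm_cart[of v k] that by linarith
  have u_sens: "H \<bullet> feedback_sens A B K j t = (K *v y t + H *v state A B K t) $ j"
    if "\<And>i. H \<bullet> state_sens A B K i t = y t $ i" for H j t and y :: "real \<Rightarrow> real^'n"
  proof -
    \<comment> \<open>The case distinction only adds a term in row \<open>j\<close>. Paired with
      \<open>H\<close> it yields coordinate \<open>j\<close> of \<open>H x\<close>; the rest yields
      that of \<open>K y\<close>.\<close>
    have "feedback_sens A B K j t = (\<chi> f g. if f = j then state A B K t $ g else 0)
        + (\<Sum>i\<in>UNIV. K $ j $ i *\<^sub>R state_sens A B K i t)"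
      by (simp add: vec_eq_iff feedback_sens_def)
    then have "H \<bullet> feedback_sens A B K j t = H \<bullet> (\<chi> f g. if f = j then state A B K t $ g else 0)
        + (\<Sum>i\<in>UNIV. K $ j $ i * y t $ i)"
      by (simp add: inner_add_right inner_sum_right that)
    also have "H \<bullet> (\<chi> f g. if f = j then state A B K t $ g else 0) = (\<Sum>g\<in>UNIV. H $ j $ g * state A B K t $ g)"
    proof -
      have "H \<bullet> (\<chi> f g. if f = j then state A B K t $ g else 0)
          = (\<Sum>f\<in>UNIV. if f = j then (\<Sum>g\<in>UNIV. H $ j $ g * state A B K t $ g) else 0)"
        unfolding inner_vec_def by (intro sum.cong) auto
      then show ?thesis by simp
    qed
    finally show ?thesis by (simp add: matrix_vector_mult_def)
  qed
  show thesis
  proof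
    show "exp_expansion (\<lambda>K' t. state A B K' t $ i) K (state_sens A B K i) b c' \<delta>" for i
      unfolding exp_expansion_def
    proof (intro conjI allI impI)
      show "continuous_on {0..} (state_sens A B K i)" by (rule state_sens_continuous[OF hw])
      show "continuous_on {0..} (\<lambda>t. state A B (K + H) t $ i)" for H
        by (intro continuous_intros state_continuous)
      show "\<bar>state A B (K + H) t $ i\<bar> \<le> c' * exp (- b * t)" if "norm H < \<delta>" "t \<ge> 0" for H t
        by (intro cut order_trans[OF x_le[OF that]] mono cc')
      fix H t assume t: "(t::real) \<ge> 0"
      obtain y where y: "state_variation A B K H y" "\<And>i t. t \<ge> 0 \<Longrightarrow> H \<bullet> state_sens A B K i t = y t $ i"
        by (rule state_sens_variation[OF hw, of H]) (rule that; assumption)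
      show "\<bar>H \<bullet> state_sens A B K i t\<bar> \<le> c' * norm H * exp (- b * t)"
        unfolding y(2)[OF t]
        by (intro cut order_trans[OF y_le[OF y(1) t]] mono mult_right_mono cc') simp
      show "\<bar>state A B (K + H) t $ i - state A B K t $ i - H \<bullet> state_sens A B K i t\<bar>
          \<le> c' * (norm H)\<^sup>2 * exp (- b * t)" if H: "norm H < \<delta>"
        unfolding y(2)[OF t] vector_minus_component[symmetric]
        by (intro cut order_trans[OF r_le[OF H y(1) t]] mono mult_right_mono cc') simp
    qed (use b cc' \<delta> in auto)
    show "exp_expansion (\<lambda>K' t. feedback A B K' t $ j) K (feedback_sens A B K j) b c' \<delta>" for j
      unfolding exp_expansion_def
    proof (intro conjI allI impI)
      have "feedback_sens A B K j = (\<lambda>t. \<chi> f g. (if f = j then state A B K t $ g else 0)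
          + (\<Sum>i\<in>UNIV. K $ j $ i * state_sens A B K i t $ f $ g))"
        by (simp add: fun_eq_iff vec_eq_iff feedback_sens_def)
      moreover have "continuous_on {0..} (\<lambda>t. \<chi> f g. (if f = j then state A B K t $ g else 0)
          + (\<Sum>i\<in>UNIV. K $ j $ i * state_sens A B K i t $ f $ g))"
      proof (intro continuous_on_vec_lambda continuous_on_add)
        show "continuous_on {0..} (\<lambda>t. if f = j then state A B K t $ g else 0)" for f g
          by (cases "f = j") (auto intro!: continuous_intros state_continuous)
      qed (intro continuous_intros state_sens_continuous[OF hw])
      ultimately show "continuous_on {0..} (feedback_sens A B K j)" by simp
      show "continuous_on {0..} (\<lambda>t. feedback A B (K + H) t $ j)" for H
        unfolding feedback_def
        by (intro continuous_intros bounded_linear.continuous_on[OF matrix_vector_mul_bounded_linear] state_continuous)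
      show "\<bar>feedback A B (K + H) t $ j\<bar> \<le> c' * exp (- b * t)" if "norm H < \<delta>" "t \<ge> 0" for H t
      proof (rule cut)
        have "norm (feedback A B (K + H) t) \<le> norm (K + H) * norm (state A B (K + H) t)"
          unfolding feedback_def by (rule norm_matrix_vector_mult_le)
        also have "\<dots> \<le> \<kappa> * (c * exp (- b * t))"
          using that norm_triangle_ineq[of K H] \<delta> by (intro mult_mono x_le) (auto simp: \<kappa>_def)
        also have "\<dots> = (c * \<kappa>) * exp (- b * t)" by simp
        also have "\<dots> \<le> c' * exp (- b * t)" by (intro mono cc')
        finally show "norm (feedback A B (K + H) t) \<le> c' * exp (- b * t)" .
      qed
      fix H t assume t: "(t::real) \<ge> 0"
      obtain y where y: "state_variation A B K H y" "\<And>i t. t \<ge> 0 \<Longrightarrow> H \<bullet> state_sens A B K i t = y t $ i"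
        by (rule state_sens_variation[OF hw, of H]) (rule that; assumption)
      note sens = u_sens[of H t y, OF y(2)[OF t]]
      show "\<bar>H \<bullet> feedback_sens A B K j t\<bar> \<le> c' * norm H * exp (- b * t)"
        unfolding sens
      proof (rule cut)
        have "norm (K *v y t + H *v state A B K t) \<le> norm K * norm (y t) + norm H * norm (state A B K t)"
          by (intro norm_triangle_mono norm_matrix_vector_mult_le)
        also have "\<dots> \<le> \<kappa> * (c * norm H * exp (- b * t)) + norm H * (c * exp (- b * t))"
          using \<kappa> by (intro add_mono mult_mono y_le[OF y(1) t] x0_le[OF t]) auto
        also have "\<dots> = (c * (\<kappa> + 1)) * norm H * exp (- b * t)" by (simp add: algebra_simps)
        also have "\<dots> \<le> c' * norm H * exp (- b * t)" by (intro mono mult_right_mono cc') simp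
        finally show "norm (K *v y t + H *v state A B K t) \<le> c' * norm H * exp (- b * t)" .
      qed
      assume H: "norm H < \<delta>"
      define r where "r = state A B (K + H) t - state A B K t - y t"
      have r: "norm r \<le> c * (norm H)\<^sup>2 * exp (- b * t)"
        unfolding r_def by (rule r_le[OF H y(1) t])
      have "feedback A B (K + H) t - feedback A B K t - (K *v y t + H *v state A B K t) = K *v r + H *v (y t + r)"
        by (simp add: feedback_def r_def matrix_vector_mult_add_rdistrib matrix_vector_mult_diff_distrib
            matrix_vector_right_distrib)
      moreover have "norm (K *v r + H *v (y t + r)) \<le> c' * (norm H)\<^sup>2 * exp (- b * t)"
      proof -
        have "norm (K *v r + H *v (y t + r)) \<le> norm K * norm r + norm H * norm (y t + r)"
          by (intro norm_triangle_mono norm_matrix_vector_mult_le)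
        also have "\<dots> \<le> norm K * norm r + norm H * (norm (y t) + norm r)"
          by (intro add_left_mono mult_left_mono norm_triangle_ineq) simp
        also have "\<dots> \<le> \<kappa> * (c * (norm H)\<^sup>2 * exp (- b * t))
            + norm H * (c * norm H * exp (- b * t) + c * (norm H)\<^sup>2 * exp (- b * t))"
          using \<kappa> by (intro add_mono mult_mono r y_le[OF y(1) t]) auto
        also have "\<dots> = (c * (\<kappa> + 1 + norm H)) * (norm H)\<^sup>2 * exp (- b * t)"
          by (simp add: algebra_simps power2_eq_square)
        also have "\<dots> \<le> c' * (norm H)\<^sup>2 * exp (- b * t)"
          unfolding c'_def using c H by (intro mono mult_right_mono mult_left_mono) auto
        finally show ?thesis .
      qed
      ultimately show "\<bar>feedback A B (K + H) t $ j - feedback A B K t $ j - H \<bullet> feedback_sens A B K j t\<bar>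
          \<le> c' * (norm H)\<^sup>2 * exp (- b * t)"
        unfolding sens vector_minus_component[symmetric] by (intro cut) simp
    qed (use b cc' \<delta> in auto)
  qed
qed

lemma inner_diag_mat: "x \<bullet> (diag_mat d *v x) = (\<Sum>i\<in>UNIV. d $ i * (x $ i)\<^sup>2)"
  by (simp add: inner_vec_def diag_mat_def matrix_vector_mult_def if_distrib if_distribR
      power2_eq_square mult_ac cong: if_cong)

theorem theorem2:
  fixes A :: "real^'n^'n" and B :: "real^'m^'n" and K :: "real^'n^'m"
    and q :: "real^'n" and r :: "real^'m"
    and Q :: "real^'n^'n" and R :: "real^'m^'m"
  assumes "CARD('m) \<ge> 2"
    and "Q = diag_mat q" and "pos_semidef Q"
    and "R = diag_mat r" and "pos_def R"
    and "stabilizable A B"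
    and "detectable A (diag_mat (\<chi> i. sqrt (q $ i)))"
    and "hurwitz (A + B ** K)"
  defines "dx_term \<equiv> (\<lambda>t. \<Sum>i\<in>UNIV. (q $ i * state A B K t $ i) *\<^sub>R state_sens A B K i t)"
    and "du_term \<equiv> (\<lambda>t. \<Sum>j\<in>UNIV. (r $ j * feedback A B K t $ j) *\<^sub>R feedback_sens A B K j t)"
  shows "(\<forall>i. \<forall>t\<ge>0. GDERIV (\<lambda>K'. state A B K' t $ i) K :> state_sens A B K i t)
    \<and> (\<forall>j. \<forall>t\<ge>0. GDERIV (\<lambda>K'. feedback A B K' t $ j) K :> feedback_sens A B K j t)
    \<and> running_cost A B Q R K absolutely_integrable_on {0..}
    \<and> dx_term absolutely_integrable_on {0..}
    \<and> du_term absolutely_integrable_on {0..}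
    \<and> GDERIV (cost A B Q R) K :> integral {0..} dx_term + integral {0..} du_term"
proof -
  let ?x = "\<lambda>i K' t. state A B K' t $ i" and ?u = "\<lambda>j K' t. feedback A B K' t $ j"
  let ?X = "\<lambda>i K'. integral {0..} (\<lambda>t. (?x i K' t)\<^sup>2 / 2)" and ?U = "\<lambda>j K'. integral {0..} (\<lambda>t. (?u j K' t)\<^sup>2 / 2)"
  obtain b c \<delta> where x: "\<And>i. exp_expansion (?x i) K (state_sens A B K i) b c \<delta>"
    and u: "\<And>j. exp_expansion (?u j) K (feedback_sens A B K j) b c \<delta>"
    using state_feedback_exp_expansion[OF assms(8)] by blast
  have \<delta>: "\<delta> > 0" using x by (auto simp: exp_expansion_def)
  note xE = exp_expansion_energy[OF x] and uE = exp_expansion_energy[OF u]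
  \<comment> \<open>Diagonal weights make the cost a weighted sum of energies of single
    coordinates.\<close>
  have rc: "running_cost A B Q R K' = (\<lambda>t. (\<Sum>i\<in>UNIV. q $ i * ((?x i K' t)\<^sup>2 / 2)) + (\<Sum>j\<in>UNIV. r $ j * ((?u j K' t)\<^sup>2 / 2)))" for K'
    by (simp add: fun_eq_iff running_cost_def assms(2,4) inner_diag_mat sum_divide_distrib add_divide_distrib)
  have rc_x: "(\<lambda>t. \<Sum>i\<in>UNIV. q $ i * ((?x i (K + H) t)\<^sup>2 / 2)) absolutely_integrable_on {0..}"
    and rc_u: "(\<lambda>t. \<Sum>j\<in>UNIV. r $ j * ((?u j (K + H) t)\<^sup>2 / 2)) absolutely_integrable_on {0..}" if "norm H < \<delta>" for H
    using xE(1)[OF that] uE(1)[OF that]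
    by (intro absolutely_integrable_sum set_integrable_mult_right finite; blast)+
  have dx: "dx_term = (\<lambda>t. \<Sum>i\<in>UNIV. q $ i *\<^sub>R (?x i K t *\<^sub>R state_sens A B K i t))"
    and du: "du_term = (\<lambda>t. \<Sum>j\<in>UNIV. r $ j *\<^sub>R (?u j K t *\<^sub>R feedback_sens A B K j t))"
    by (simp_all add: dx_term_def du_term_def)
  have dx_int: "integral {0..} dx_term = (\<Sum>i\<in>UNIV. q $ i *\<^sub>R integral {0..} (\<lambda>t. ?x i K t *\<^sub>R state_sens A B K i t))"
    unfolding dx using xE(2)[THEN set_lebesgue_integral_eq_integral(1)]
    by (simp add: integral_sum integrable_cmul del: scaleR_scaleR)
  have du_int: "integral {0..} du_term = (\<Sum>j\<in>UNIV. r $ j *\<^sub>R integral {0..} (\<lambda>t. ?u j K t *\<^sub>R feedback_sens A B K j t))"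
    unfolding du using uE(2)[THEN set_lebesgue_integral_eq_integral(1)]
    by (simp add: integral_sum integrable_cmul del: scaleR_scaleR)
  \<comment> \<open>The splitting needs convergent integrals, since \<open>integral\<close>
    otherwise returns the default 0. It is claimed only within \<open>\<delta>\<close> of
    \<open>K\<close>, which determines the derivative.\<close>
  have cost_eq: "cost A B Q R (K + H) = (\<Sum>i\<in>UNIV. q $ i * ?X i (K + H)) + (\<Sum>j\<in>UNIV. r $ j * ?U j (K + H))"
    if H: "norm H < \<delta>" for H
  proof -
    have "cost A B Q R (K + H) = integral {0..} (\<lambda>t. \<Sum>i\<in>UNIV. q $ i * ((?x i (K + H) t)\<^sup>2 / 2))
        + integral {0..} (\<lambda>t. \<Sum>j\<in>UNIV. r $ j * ((?u j (K + H) t)\<^sup>2 / 2))"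
      unfolding cost_def rc
      by (intro integral_add set_lebesgue_integral_eq_integral(1) rc_x[OF H] rc_u[OF H])
    also have "integral {0..} (\<lambda>t. \<Sum>i\<in>UNIV. q $ i * ((?x i (K + H) t)\<^sup>2 / 2)) = (\<Sum>i\<in>UNIV. q $ i * ?X i (K + H))"
      using xE(1)[OF H, THEN set_lebesgue_integral_eq_integral(1)]
      by (subst integral_sum) (auto intro!: integrable_on_mult_right simp del: times_divide_eq_right)
    also have "integral {0..} (\<lambda>t. \<Sum>j\<in>UNIV. r $ j * ((?u j (K + H) t)\<^sup>2 / 2)) = (\<Sum>j\<in>UNIV. r $ j * ?U j (K + H))"
      using uE(1)[OF H, THEN set_lebesgue_integral_eq_integral(1)]
      by (subst integral_sum) (auto intro!: integrable_on_mult_right simp del: times_divide_eq_right)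
    finally show ?thesis .
  qed
  have "GDERIV (cost A B Q R) K :> integral {0..} dx_term + integral {0..} du_term"
    unfolding gderiv_def
  proof (rule has_derivative_transform_within[OF _ \<delta>])
    show "((\<lambda>K'. (\<Sum>i\<in>UNIV. q $ i * ?X i K') + (\<Sum>j\<in>UNIV. r $ j * ?U j K')) has_derivative
        (\<lambda>h. h \<bullet> (integral {0..} dx_term + integral {0..} du_term))) (at K)"
      unfolding dx_int du_int inner_add_right inner_sum_right inner_scaleR_right
      by (intro has_derivative_add has_derivative_sum has_derivative_mult_right
          xE(3)[unfolded gderiv_def] uE(3)[unfolded gderiv_def])
    show "(\<Sum>i\<in>UNIV. q $ i * ?X i K') + (\<Sum>j\<in>UNIV. r $ j * ?U j K') = cost A B Q R K'" if "dist K' K < \<delta>" for K'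
      using cost_eq[of "K' - K"] that by (simp add: dist_norm)
  qed simp
  moreover have "running_cost A B Q R K absolutely_integrable_on {0..}"
    unfolding rc using set_integral_add(1)[OF rc_x[of 0] rc_u[of 0]] \<delta> by simp
  moreover have "dx_term absolutely_integrable_on {0..}" "du_term absolutely_integrable_on {0..}"
    unfolding dx du
    by (intro absolutely_integrable_sum finite absolutely_integrable_scaleR_left xE(2) uE(2))+
  ultimately show ?thesis
    using exp_expansion_gderiv[OF x] exp_expansion_gderiv[OF u] by blast
qed

end
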